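(* Let $H$ be an uncountable abelian Polish group. Then there is an analytic ideal $\mathcal{Z}$ over $\mathbb{N}$ that is not a Radon--Nikodym ideal for maps $H\to H^{\mathbb{N}}$, in the sense that there exists a Borel map $f:H\to H^{\mathbb{N}}$ which is a $\mathcal{Z}$-approximate homomorphism but which is not $\mathcal{Z}$-approximable by a continuous homomorphism, i.e. there is no continuous group homomorphism $g:H\to H^{\mathbb{N}}$ such that $\{a\in\mathbb{N} : f(x)(a)\neq g(x)(a)\}\in\mathcal{Z}$ for all $x\in H$. If moreover $H$ is $\sigma$-compact, then $\mathcal{Z}$ can be chosen to be $\mathbf{F}_\sigma$.
   Context: An ideal over a countable set $A$ is a family $\mathcal{Z}\subseteq\mathcal{P}(A)$ closed under subsets and finite unions. It is called analytic (resp. $\mathbf{F}_\sigma$) if it is an analytic (resp. $\mathbf{F}_\sigma$) subset of $\mathcal{P}(A)$, identified with the Cantor-type space $2^{A}$ with the product topology. For an abelian Polish group $H$, $H^{A}$ denotes the product group with the product topology. A map $f:H\to H^{A}$ is a $\mathcal{Z}$-approximate homomorphism if for all $x,y\in H$ the set $\{a\in A : f(x)(a)+f(y)(a)\neq f(x+y)(a)\}$ belongs to $\mathcal{Z}$, where $+$ is the group operation of $H$. *)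

theory Defs
  imports "HOL-Analysis.Analysis" "HOL-Library.Function_Algebras"
begin

definition sigma_compact :: "'a::topological_space set \<Rightarrow> bool" where
  "sigma_compact S \<longleftrightarrow> (\<exists>K :: nat \<Rightarrow> 'a set. (\<forall>n. compact (K n)) \<and> S = (\<Union>n. K n))"

definition Polish_topology :: "'a topology \<Rightarrow> bool" where
  "Polish_topology T \<longleftrightarrow> completely_metrizable_space T \<and> separable_space T"

(* Continuous images of Polish spaces. A Polish space has at most continuum many points, so up to
   homeomorphism its carrier (the topspace, an arbitrary subset of the type) is a set of reals;
   the topology T is arbitrary and unrelated to that of the real line. *)
definition analytic_set :: "'a::topological_space set \<Rightarrow> bool" where
  "analytic_set S \<longleftrightarrow>
     (\<exists>(T :: real topology) h. Polish_topology T \<and> continuous_map T euclidean h \<and> h ` topspace T = S)"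

(* The identification of the power set of the type 'i with the space of functions 'i \<Rightarrow> bool,
   which carries the product topology with bool discrete. *)
definition char_funs :: "'i set set \<Rightarrow> ('i \<Rightarrow> bool) set" where
  "char_funs Z = (\<lambda>A i. i \<in> A) ` Z"

(* Ideals over the whole type 'i. The empty set is the empty finite union; properness is not
   part of the notion. *)
definition set_ideal :: "'i set set \<Rightarrow> bool" where
  "set_ideal Z \<longleftrightarrow>
     {} \<in> Z \<and> (\<forall>A\<in>Z. \<forall>B. B \<subseteq> A \<longrightarrow> B \<in> Z) \<and> (\<forall>A\<in>Z. \<forall>B\<in>Z. A \<union> B \<in> Z)"

definition analytic_ideal :: "'i set set \<Rightarrow> bool" where
  "analytic_ideal Z \<longleftrightarrow> set_ideal Z \<and> analytic_set (char_funs Z)"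

definition Fsigma_ideal :: "'i set set \<Rightarrow> bool" where
  "Fsigma_ideal Z \<longleftrightarrow> set_ideal Z \<and> fsigma_in euclidean (char_funs Z)"

definition approximate_hom :: "'i set set \<Rightarrow> ('h::ab_group_add \<Rightarrow> 'i \<Rightarrow> 'h) \<Rightarrow> bool" where
  "approximate_hom Z f \<longleftrightarrow> (\<forall>x y. {a. f x a + f y a \<noteq> f (x + y) a} \<in> Z)"

(* On the right, + is the pointwise addition of 'i \<Rightarrow> 'h. *)
definition continuous_hom :: "('h::topological_ab_group_add \<Rightarrow> 'i \<Rightarrow> 'h) \<Rightarrow> bool" where
  "continuous_hom g \<longleftrightarrow> continuous_on UNIV g \<and> (\<forall>x y. g (x + y) = g x + g y)"

definition approximable_by_continuous_hom ::
    "'i set set \<Rightarrow> ('h::topological_ab_group_add \<Rightarrow> 'i \<Rightarrow> 'h) \<Rightarrow> bool" where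
  "approximable_by_continuous_hom Z f \<longleftrightarrow>
     (\<exists>g. continuous_hom g \<and> (\<forall>x. {a. f x a \<noteq> g x a} \<in> Z))"

end

(* Let f be a countable family of functions f_a that are constant near each point of an open set R_a,
   and put A in Z when some finite set S of group elements is respected by no f_a with a in A: S is not
   contained in R_a, or f_a is not additive on S. The triples {x, y, x + y} make f a Z-approximate
   homomorphism.

   If continuous homomorphisms g_a approximate f, then every x has a finite set S_x containing x such
   that f_a x = g_a x whenever f_a respects S_x. By the Baire category theorem, and because a
   projection of a closed set that is not meager is comeager in some open set, the size of S_x can be
   bounded by m on a set that contains x0 + (L + L + L) for a large finite set L of small tripling.
   Let F consist of the points that lie in many of these S_x. By pigeonhole two sets S_x and S_x' have
   the same additive type over F, so u |-> u' - u is a partial homomorphism on S_x that vanishes on F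
   but not at x. For most s, t in L the set S_x meets the sets of x + s, x + t and x + s + t only
   inside F, so some f_a extends (a copy of) this map by 0 to those three sets. Then g_a is nonzero at x
   and zero at the other three corners of a parallelogram, which is impossible. *)
theory Submission
  imports Defs
begin

section \<open>Category\<close>

definition meager :: "'a::topological_space set \<Rightarrow> bool" where
  "meager M \<longleftrightarrow> (\<exists>N. countable N \<and> (\<forall>T\<in>N. closed T \<and> interior T = {}) \<and> M \<subseteq> \<Union>N)"

lemma meager_subset: "meager M \<Longrightarrow> M' \<subseteq> M \<Longrightarrow> meager M'"
  unfolding meager_def by (meson subset_trans)

lemma meager_nowhere_dense: "closed T \<Longrightarrow> interior T = {} \<Longrightarrow> meager T"
  unfolding meager_def by (intro exI[of _ "{T}"]) auto

lemma meager_frontier: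
  assumes "closed T"
  shows "meager (frontier T)"
proof (rule meager_nowhere_dense)
  have "interior (frontier T) \<subseteq> interior T"
    using assms by (intro interior_mono frontier_subset_closed)
  then show "interior (frontier T) = {}"
    using interior_subset[of "frontier T"] unfolding frontier_def by blast
qed (rule frontier_closed)

lemma meager_empty [simp]: "meager {}"
  by (rule meager_nowhere_dense) auto

lemma meager_UN:
  assumes "countable I" "\<And>i. i \<in> I \<Longrightarrow> meager (M i)"
  shows "meager (\<Union>i\<in>I. M i)"
proof -
  obtain N where N: "\<And>i. i \<in> I \<Longrightarrow> countable (N i)"
      "\<And>i T. i \<in> I \<Longrightarrow> T \<in> N i \<Longrightarrow> closed T \<and> interior T = {}"
      "\<And>i. i \<in> I \<Longrightarrow> M i \<subseteq> \<Union>(N i)"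
    using assms(2) unfolding meager_def by metis
  show ?thesis
    unfolding meager_def
  proof (intro exI conjI)
    show "countable (\<Union>i\<in>I. N i)" using assms(1) N(1) by blast
    show "\<forall>T\<in>\<Union>i\<in>I. N i. closed T \<and> interior T = {}" using N(2) by blast
    show "(\<Union>i\<in>I. M i) \<subseteq> \<Union>(\<Union>i\<in>I. N i)"
    proof
      fix x assume "x \<in> (\<Union>i\<in>I. M i)"
      then obtain i where "i \<in> I" "x \<in> M i" by blast
      then show "x \<in> \<Union>(\<Union>i\<in>I. N i)" using N(3)[of i] by blast
    qed
  qed
qed

lemma meager_Un: "meager M \<Longrightarrow> meager M' \<Longrightarrow> meager (M \<union> M')"
  using meager_UN[of "{True, False}" "\<lambda>b. if b then M else M'"] by (simp add: Un_commute)

lemma open_not_meager: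
  fixes U :: "'a::complete_space set"
  assumes "open U" "U \<noteq> {}"
  shows "\<not> meager U"
proof
  assume "meager U"
  then obtain N where N: "countable N" "\<forall>T\<in>N. closed T \<and> interior T = {}" "U \<subseteq> \<Union>N"
    unfolding meager_def by blast
  have "interior (\<Union>N) = {}"
    using Baire_category_alt[OF disjI1[OF completely_metrizable_space_euclidean] N(1)] N(2) by simp
  then show False using assms N(3) by (metis interior_maximal subset_empty)
qed

section \<open>Local category and projections of closed sets\<close>

text \<open>These are the points at which \<open>S\<close> is locally nonmeager: every open set
  around such a point meets \<open>S\<close> in a nonmeager set.\<close>

definition category_closure :: "'a::topological_space set \<Rightarrow> 'a set" where
  "category_closure S = - \<Union>{U. open U \<and> meager (S \<inter> U)}"

lemma closed_category_closure: "closed (category_closure S)"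
  unfolding category_closure_def closed_def by auto

lemma category_closure_subset_closure: "category_closure S \<subseteq> closure S"
proof
  fix x assume "x \<in> category_closure S"
  moreover have "S \<inter> - closure S = {}"
    using closure_subset by auto
  then have "meager (S \<inter> - closure S)" by simp
  moreover have "open (- closure S)" by auto
  ultimately show "x \<in> closure S" unfolding category_closure_def by blast
qed

text \<open>Every point of the difference has an open neighbourhood in which \<open>S\<close> is
  meager. A basic open set inside it has the same property, and there are only countably many of
  those.\<close>

lemma meager_diff_category_closure:
  fixes S :: "'a::second_countable_topology set"
  shows "meager (S - category_closure S)"
proof -
  obtain B :: "'a set set" where B: "countable B" "topological_basis B"
    using ex_countable_basis by auto
  have "S - category_closure S \<subseteq> (\<Union>U\<in>{U\<in>B. meager (S \<inter> U)}. S \<inter> U)"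
  proof
    fix x assume x: "x \<in> S - category_closure S"
    then obtain U where U: "open U" "meager (S \<inter> U)" "x \<in> U"
      unfolding category_closure_def by auto
    obtain W where "W \<in> B" "x \<in> W" "W \<subseteq> U"
      using topological_basisE[OF B(2) U(1,3)] .
    then show "x \<in> (\<Union>U\<in>{U\<in>B. meager (S \<inter> U)}. S \<inter> U)"
      using x U(2) meager_subset[of "S \<inter> U" "S \<inter> W"] by auto
  qed
  moreover have "meager (\<Union>U\<in>{U\<in>B. meager (S \<inter> U)}. S \<inter> U)"
    using B(1) by (intro meager_UN) auto
  ultimately show ?thesis by (rule meager_subset[rotated])
qed

text \<open>This is the Baire property of analytic sets: \<open>A s\<close> is the projection of the part of \<open>C\<close> over
  a piece of diameter at most \<open>1 / n\<close>, and outside the meager sets \<open>E s\<close> a point of the category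
  closure can be followed down the tree of pieces to a point of \<open>C\<close>.\<close>

lemma closed_projection_comeager_in_open:
  fixes C :: "('a::{metric_space, second_countable_topology} \<times>
                'b::{complete_space, second_countable_topology}) set"
  assumes C: "closed C" and nonmeager: "\<not> meager (fst ` C)"
  shows "\<exists>U. open U \<and> U \<noteq> {} \<and> meager (U - fst ` C)"
proof -
  obtain D :: "'b set" where D: "countable D" "\<And>X. open X \<Longrightarrow> X \<noteq> {} \<Longrightarrow> \<exists>d\<in>D. d \<in> X"
    using countable_dense_setE by metis
  have Dne: "D \<noteq> {}" using D(2)[of UNIV] by auto
  define P where "P n i = ball (from_nat_into D i) (1 / (2 * real (Suc n)))" for n i :: nat
  have P_cover: "\<exists>i. y \<in> P n i" for n y
  proof -
    obtain d where d: "d \<in> D" "d \<in> ball y (1 / (2 * real (Suc n)))"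
      using D(2)[of "ball y (1 / (2 * real (Suc n)))"] by auto
    then obtain i where "from_nat_into D i = d"
      using D(1) from_nat_into_surj by metis
    then show ?thesis using d unfolding P_def by (auto simp: dist_commute)
  qed
  have P_small: "dist y z < 1 / real (Suc n)" if "y \<in> P n i" "z \<in> P n i" for y z n i
  proof -
    have "dist y z < 1 / (2 * real (Suc n)) + 1 / (2 * real (Suc n))"
      using that unfolding P_def mem_ball by (intro dist_triangle_less_add) (auto simp: dist_commute)
    then show ?thesis by (simp add: field_simps)
  qed
  define Y where "Y s = {y. \<forall>k<length s. y \<in> P k (s ! k)}" for s :: "nat list"
  define A where "A s = fst ` (C \<inter> UNIV \<times> Y s)" for s
  \<comment> \<open>\<open>E s\<close> collects the points at which the descent can get stuck.
    Interiors are removed, rather than the category closures themselves, so that \<open>E s\<close>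
    is closed.\<close>
  define E where "E s = category_closure (A s) - (\<Union>i. interior (category_closure (A (s @ [i]))))" for s
  have A_split: "A s \<subseteq> (\<Union>i. A (s @ [i]))" for s
  proof
    fix x assume "x \<in> A s"
    then obtain y where y: "(x, y) \<in> C" "y \<in> Y s" unfolding A_def by auto
    obtain i where "y \<in> P (length s) i" using P_cover by blast
    then have "y \<in> Y (s @ [i])"
      using y(2) unfolding Y_def by (auto simp: nth_append less_Suc_eq)
    then show "x \<in> (\<Union>i. A (s @ [i]))" using y(1) unfolding A_def by force
  qed
  have "meager (E s)" for s
  proof (rule meager_nowhere_dense)
    show "closed (E s)" unfolding E_def
      by (intro closed_Diff closed_category_closure open_UN) auto
    show "interior (E s) = {}"
    proof (rule ccontr)
      define U where "U = interior (E s)"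
      assume "interior (E s) \<noteq> {}"
      then obtain x where x: "x \<in> U" unfolding U_def by auto
      have U: "open U" "U \<subseteq> E s" unfolding U_def by (auto simp: interior_subset)
      let ?T = "\<lambda>i. category_closure (A (s @ [i]))"
      \<comment> \<open>A point of \<open>A s\<close> in \<open>U\<close> lies in some child of
        \<open>s\<close> but not in the interior of that child's category closure. So it lies
        outside that closure or on its frontier, and both cases give a meager set.\<close>
      have "A s \<inter> U \<subseteq> (\<Union>i. (A (s @ [i]) - ?T i) \<union> frontier (?T i))"
      proof
        fix z assume z: "z \<in> A s \<inter> U"
        then obtain i where "z \<in> A (s @ [i])" using A_split by blast
        moreover have "z \<notin> interior (?T i)" using z U(2) unfolding E_def by blast
        ultimately have "z \<in> (A (s @ [i]) - ?T i) \<union> frontier (?T i)"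
          unfolding frontier_def using closure_subset by fastforce
        then show "z \<in> (\<Union>i. (A (s @ [i]) - ?T i) \<union> frontier (?T i))" by blast
      qed
      moreover have "meager (\<Union>i. (A (s @ [i]) - ?T i) \<union> frontier (?T i))"
        by (intro meager_UN meager_Un meager_diff_category_closure meager_frontier
              closed_category_closure) auto
      ultimately have "meager (A s \<inter> U)" by (rule meager_subset[rotated])
      then have "x \<notin> category_closure (A s)"
        using x U(1) unfolding category_closure_def by auto
      then show False using x U(2) unfolding E_def by blast
    qed
  qed
  then have meager_E: "meager (\<Union>s. E s)" by (intro meager_UN) auto
  define W where "W = interior (category_closure (fst ` C))"
  have A_Nil: "A [] = fst ` C" unfolding A_def Y_def by simp
  have "W \<noteq> {}"
  proof
    assume "W = {}"
    then have "meager (category_closure (fst ` C))"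
      unfolding W_def by (intro meager_nowhere_dense closed_category_closure)
    then have "meager ((fst ` C - category_closure (fst ` C)) \<union> category_closure (fst ` C))"
      by (intro meager_Un meager_diff_category_closure)
    then have "meager (fst ` C)" by (rule meager_subset) blast
    then show False using nonmeager by blast
  qed
  moreover have "W - fst ` C \<subseteq> (\<Union>s. E s)"
  proof (rule ccontr)
    assume "\<not> W - fst ` C \<subseteq> (\<Union>s. E s)"
    then obtain x where x: "x \<in> W" "x \<notin> fst ` C" "\<And>s. x \<notin> E s" by blast
    have step: "\<exists>i. x \<in> category_closure (A (s @ [i]))" if s: "x \<in> category_closure (A s)" for s
    proof -
      obtain i where "x \<in> interior (category_closure (A (s @ [i])))"
        using x(3)[of s] s unfolding E_def by blast
      then show ?thesis using interior_subset by blast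
    qed
    obtain s where s: "\<And>n::nat. x \<in> category_closure (A (s n)) \<and> length (s n) = n"
        "\<And>n. \<exists>i. s (Suc n) = s n @ [i]"
    proof (rule exE[OF dependent_nat_choice[of
          "\<lambda>n s. x \<in> category_closure (A s) \<and> length s = n" "\<lambda>n s s'. \<exists>i. s' = s @ [i]"]])
      show "\<exists>s. x \<in> category_closure (A s) \<and> length s = 0"
        using x(1) interior_subset[of "category_closure (fst ` C)"] A_Nil
        unfolding W_def by (intro exI[of _ "[]"]) auto
      show "\<exists>s'. (x \<in> category_closure (A s') \<and> length s' = Suc n) \<and> (\<exists>i. s' = s @ [i])"
        if "x \<in> category_closure (A s) \<and> length s = n" for s n
        using step[of s] that by (metis length_append_singleton)
    qed blast
    have prefix: "s m ! k = s n ! k" if "k < n" "n \<le> m" for k n m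
      using that(2)
    proof (induction m rule: dec_induct)
      case (step m)
      obtain i where "s (Suc m) = s m @ [i]" using s(2) by blast
      then show ?case using step that(1) s(1)[of m] by (simp add: nth_append)
    qed simp
    \<comment> \<open>A category closure lies in the ordinary closure, so each level yields a point
      of \<open>C\<close> over the current piece whose first coordinate is close to
      \<open>x\<close>. The second coordinates form a Cauchy sequence because the sets
      \<open>Y (s n)\<close> decrease and their diameters tend to 0.\<close>
    have "\<exists>p. p \<in> C \<and> snd p \<in> Y (s n) \<and> dist (fst p) x < 1 / real (Suc n)" for n
    proof -
      have "x \<in> closure (A (s n))" using s(1) category_closure_subset_closure by blast
      moreover have "0 < 1 / real (Suc n)" by simp
      ultimately obtain z where "z \<in> A (s n)" "dist z x < 1 / real (Suc n)"
        unfolding closure_approachable by blast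
      then show ?thesis unfolding A_def by force
    qed
    then obtain p where p: "\<And>n. p n \<in> C" "\<And>n. snd (p n) \<in> Y (s n)"
        "\<And>n. dist (fst (p n)) x < 1 / real (Suc n)" by metis
    have lim_inv: "(\<lambda>n. 1 / real (Suc n)) \<longlonglongrightarrow> 0"
      using LIMSEQ_inverse_real_of_nat by (simp add: inverse_eq_divide)
    have fst_lim: "(\<lambda>n. fst (p n)) \<longlonglongrightarrow> x"
      by (rule metric_tendsto_imp_tendsto[OF lim_inv])
         (use p(3) in \<open>simp add: dist_real_def less_imp_le\<close>)
    have "Cauchy (\<lambda>n. snd (p n))"
    proof (rule metric_CauchyI)
      fix e :: real assume "0 < e"
      then obtain n where n: "1 / real (Suc n) < e"
        by (metis nat_approx_posE)
      have in_P: "snd (p m) \<in> P n (s (Suc n) ! n)" if "m \<ge> Suc n" for m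
      proof -
        have "snd (p m) \<in> P n (s m ! n)"
          using p(2)[of m] that s(1)[of m] unfolding Y_def by simp
        then show ?thesis using prefix[of n "Suc n" m] that by simp
      qed
      have "dist (snd (p m)) (snd (p k)) < e" if "m \<ge> Suc n" "k \<ge> Suc n" for m k
        using P_small[OF in_P[OF that(1)] in_P[OF that(2)]] n by (rule less_trans)
      then show "\<exists>M. \<forall>m\<ge>M. \<forall>k\<ge>M. dist (snd (p m)) (snd (p k)) < e" by blast
    qed
    then obtain y where "(\<lambda>n. snd (p n)) \<longlonglongrightarrow> y"
      using Cauchy_convergent convergent_def by blast
    then have "p \<longlonglongrightarrow> (x, y)" using tendsto_Pair[OF fst_lim, of "\<lambda>n. snd (p n)" y] by simp
    then have "(x, y) \<in> C" using C p(1) closed_sequentially by blast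
    then show False using x(2) by force
  qed
  then have "meager (W - fst ` C)" by (rule meager_subset[OF meager_E])
  moreover have "open W" unfolding W_def by simp
  ultimately show ?thesis by blast
qed

lemma meager_translate:
  fixes M :: "'a::topological_ab_group_add set"
  assumes "meager M"
  shows "meager ((\<lambda>x. x + l) -` M)"
proof -
  obtain N where N: "countable N" "\<And>T. T \<in> N \<Longrightarrow> closed T \<and> interior T = {}" "M \<subseteq> \<Union>N"
    using assms unfolding meager_def by blast
  have "meager (\<Union>T\<in>N. (\<lambda>x. x + l) -` T)"
  proof (intro meager_UN N(1) meager_nowhere_dense)
    fix T assume T: "T \<in> N"
    show "closed ((\<lambda>x. x + l) -` T)"
      using N(2)[OF T] by (intro closed_vimage continuous_intros) auto
    let ?O = "interior ((\<lambda>x. x + l) -` T)"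
    have "open ((\<lambda>x. x - l) -` ?O)"
      by (intro open_vimage open_interior continuous_intros)
    moreover have "(\<lambda>x. x - l) -` ?O \<subseteq> T"
      using interior_subset[of "(\<lambda>x. x + l) -` T"] by force
    ultimately have "(\<lambda>x. x - l) -` ?O \<subseteq> interior T" by (rule interior_maximal[rotated])
    then have empty: "(\<lambda>x. x - l) -` ?O = {}" using N(2)[OF T] by blast
    have "x \<notin> ?O" for x
    proof
      assume "x \<in> ?O"
      then have "x + l \<in> (\<lambda>x. x - l) -` ?O" by simp
      then show False using empty by blast
    qed
    then show "?O = {}" by blast
  qed
  then show ?thesis by (rule meager_subset) (use N(3) in blast)
qed

section \<open>Finite sets of small tripling\<close>

primrec nsmul :: "nat \<Rightarrow> 'a::monoid_add \<Rightarrow> 'a" where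
  "nsmul 0 p = 0"
| "nsmul (Suc k) p = p + nsmul k p"

lemma nsmul_add: "nsmul (j + k) p = nsmul j p + nsmul k p"
  by (induction j) (simp_all add: add.assoc)

lemma nsmul_zero_right [simp]: "nsmul k 0 = 0"
  by (induction k) simp_all

lemma nsmul_mult: "nsmul (j * k) p = nsmul j (nsmul k p)"
  by (induction j) (simp_all add: nsmul_add)

lemma nsmul_mod:
  assumes "nsmul M p = 0"
  shows "nsmul (k mod M) p = nsmul k p"
proof -
  have "nsmul k p = nsmul (k div M * M + k mod M) p" by simp
  also have "\<dots> = nsmul (k mod M) p"
    unfolding nsmul_add nsmul_mult assms by simp
  finally show ?thesis by simp
qed

lemma continuous_on_nsmul: "continuous_on UNIV (nsmul k :: 'a::topological_monoid_add \<Rightarrow> 'a)"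
proof (induction k)
  case (Suc k)
  then have "continuous_on UNIV (\<lambda>p :: 'a. p + nsmul k p)" by (intro continuous_intros)
  then show ?case by simp
qed simp

lemma nsmul_neighbourhood:
  fixes V :: "'a::topological_monoid_add set"
  assumes "open V" "0 \<in> V"
  obtains W where "open W" "0 \<in> W" "\<And>p k. p \<in> W \<Longrightarrow> k \<le> n \<Longrightarrow> nsmul k p \<in> V"
proof
  show "open (\<Inter>k\<le>n. nsmul k -` V)"
    using assms(1) continuous_on_nsmul by (intro open_INT ballI open_vimage) auto
qed (use assms(2) in auto)

lemma add_neighbourhood:
  fixes V :: "'a::topological_monoid_add set"
  assumes "open V" "0 \<in> V"
  obtains W where "open W" "0 \<in> W" "\<And>p q. p \<in> W \<Longrightarrow> q \<in> W \<Longrightarrow> p + q \<in> V"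
proof -
  have "open ((\<lambda>x :: 'a \<times> 'a. fst x + snd x) -` V)"
    using assms(1) by (intro open_vimage continuous_intros)
  moreover have "(0, 0) \<in> (\<lambda>x :: 'a \<times> 'a. fst x + snd x) -` V"
    using assms(2) by simp
  ultimately obtain A B where "open A" "open B" "(0, 0) \<in> A \<times> B"
      "A \<times> B \<subseteq> (\<lambda>x. fst x + snd x) -` V"
    by (rule open_prod_elim)
  then show ?thesis by (intro that[of "A \<inter> B"]) auto
qed

text \<open>Three summands, because the parallelogram found later takes its base point from a
  translate of \<open>L\<close> and both of its sides from \<open>L\<close>.\<close>

definition sumset3 :: "'a::plus set \<Rightarrow> 'a set" where
  "sumset3 L = (\<lambda>(a, b, c). a + b + c) ` (L \<times> L \<times> L)"

lemma sumset3I: "a \<in> L \<Longrightarrow> b \<in> L \<Longrightarrow> c \<in> L \<Longrightarrow> a + b + c \<in> sumset3 L"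
  unfolding sumset3_def by force

lemma finite_sumset3 [simp]: "finite L \<Longrightarrow> finite (sumset3 L)"
  unfolding sumset3_def by simp

text \<open>By induction on \<open>n\<close>: adjoin to \<open>L\<close> a point \<open>p\<close>
  outside it, so close to 0 that its multiples up to \<open>M\<close> stay in \<open>V1\<close>. As
  \<open>nsmul M p = 0\<close>, the sums of elements of \<open>L\<close> and multiples of
  \<open>p\<close> form a finite set closed under addition.\<close>

lemma large_finite_subgroup_in_neighbourhood:
  fixes V W :: "'a::{topological_ab_group_add, t1_space} set"
  assumes nondiscrete: "\<not> open {0 :: 'a}"
    and W: "open W" "0 \<in> W" and M: "M > 0" "\<And>p. p \<in> W \<Longrightarrow> nsmul M p = 0"
    and V: "open V" "0 \<in> V"
  shows "\<exists>L. finite L \<and> 0 \<in> L \<and> n \<le> card L \<and> L \<subseteq> V \<and> (\<forall>a\<in>L. \<forall>b\<in>L. a + b \<in> L)"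
  using V
proof (induction n arbitrary: V)
  case 0
  then show ?case by (intro exI[of _ "{0}"]) auto
next
  case (Suc n)
  obtain V1 where V1: "open V1" "0 \<in> V1" "\<And>p q. p \<in> V1 \<Longrightarrow> q \<in> V1 \<Longrightarrow> p + q \<in> V"
    using add_neighbourhood[OF Suc.prems] by blast
  obtain L where L: "finite L" "0 \<in> L" "n \<le> card L" "L \<subseteq> V1" "\<And>a b. a \<in> L \<Longrightarrow> b \<in> L \<Longrightarrow> a + b \<in> L"
    using Suc.IH[OF V1(1,2)] by blast
  obtain U where U: "open U" "0 \<in> U" "\<And>p k. p \<in> U \<Longrightarrow> k \<le> M \<Longrightarrow> nsmul k p \<in> V1"
    using nsmul_neighbourhood[OF V1(1,2)] by blast
  \<comment> \<open>A finite open neighbourhood of 0 would make \<open>{0}\<close> open, since its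
    other points can be removed in a T1 space.\<close>
  have "\<not> U \<inter> W \<subseteq> L"
  proof
    assume "U \<inter> W \<subseteq> L"
    then have "finite (U \<inter> W)" using L(1) finite_subset by blast
    then have "open (U \<inter> W - (U \<inter> W - {0}))"
      using U(1) W(1) by (intro open_Diff finite_imp_closed) auto
    moreover have "U \<inter> W - (U \<inter> W - {0}) = {0}" using U(2) W(2) by auto
    ultimately show False using nondiscrete by simp
  qed
  then obtain p where p: "p \<in> U" "p \<in> W" "p \<notin> L" by blast
  define L' where "L' = (\<lambda>(l, k). l + nsmul k p) ` (L \<times> {..<M})"
  have in_L': "l + nsmul k p \<in> L'" if "l \<in> L" for l k
  proof -
    have "l + nsmul (k mod M) p \<in> L'" using that M(1) unfolding L'_def by force
    then show ?thesis using nsmul_mod[OF M(2)[OF p(2)]] by simp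
  qed
  have finite: "finite L'" unfolding L'_def using L(1) by simp
  have "l \<in> L'" if "l \<in> L" for l using in_L'[OF that, of 0] by simp
  moreover have "p \<in> L'" using in_L'[OF L(2), of 1] by simp
  ultimately have "insert p L \<subseteq> L'" by blast
  then have "card (insert p L) \<le> card L'" using finite by (rule card_mono[rotated])
  then have "Suc n \<le> card L'" using L(1,3) p(3) by simp
  moreover have "0 \<in> L'" using in_L'[OF L(2), of 0] by simp
  moreover have "L' \<subseteq> V" unfolding L'_def using V1(3) L(4) U(3)[OF p(1)] by auto
  moreover have "a + b \<in> L'" if ab: "a \<in> L'" "b \<in> L'" for a b
  proof -
    obtain l k l' k' where "l \<in> L" "l' \<in> L" "a = l + nsmul k p" "b = l' + nsmul k' p"
      using ab unfolding L'_def by auto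
    then show ?thesis using in_L'[OF L(5), of l l' "k + k'"] by (simp add: nsmul_add algebra_simps)
  qed
  ultimately show ?case using finite by (intro exI[of _ L']) blast
qed

text \<open>There are two cases. If some \<open>p\<close> near 0 has no vanishing multiple up to
  \<open>N\<close>, the progression of its multiples from 0 to \<open>N\<close> has
  \<open>N + 1\<close> elements and at most \<open>3 * N + 1\<close> triple sums. Otherwise
  \<open>fact N\<close> annihilates a neighbourhood of 0, and a large finite subgroup
  serves.\<close>

lemma small_tripling_in_neighbourhood:
  fixes V :: "'a::{topological_ab_group_add, t1_space} set"
  assumes nondiscrete: "\<not> open {0 :: 'a}" and V: "open V" "0 \<in> V"
  shows "\<exists>L. finite L \<and> 0 \<in> L \<and> N \<le> card L \<and> sumset3 L \<subseteq> V \<and> card (sumset3 L) \<le> 3 * card L"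
proof -
  obtain W where W: "open W" "0 \<in> W" "\<And>p k. p \<in> W \<Longrightarrow> k \<le> 3 * N \<Longrightarrow> nsmul k p \<in> V"
    using nsmul_neighbourhood[OF V] by blast
  show ?thesis
  proof (cases "\<exists>p\<in>W. \<forall>k\<in>{1..N}. nsmul k p \<noteq> 0")
    case True
    then obtain p where p: "p \<in> W" "\<And>k. 1 \<le> k \<Longrightarrow> k \<le> N \<Longrightarrow> nsmul k p \<noteq> 0" by auto
    define L where "L = (\<lambda>k. nsmul k p) ` {..N}"
    have "inj_on (\<lambda>k. nsmul k p) {..N}"
    proof (rule linorder_inj_onI)
      fix j k assume jk: "j < k" "k \<in> {..N}"
      then have "nsmul k p = nsmul j p + nsmul (k - j) p" using nsmul_add[of j "k - j" p] by simp
      then show "nsmul j p \<noteq> nsmul k p" using p(2)[of "k - j"] jk by simp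
    qed auto
    then have card: "card L = Suc N" unfolding L_def by (simp add: card_image)
    have sub: "sumset3 L \<subseteq> (\<lambda>k. nsmul k p) ` {..3 * N}"
    proof
      fix x assume "x \<in> sumset3 L"
      then obtain i j k where "i \<le> N" "j \<le> N" "k \<le> N" "x = nsmul i p + nsmul j p + nsmul k p"
        unfolding sumset3_def L_def by auto
      then have "x = nsmul (i + j + k) p" "i + j + k \<le> 3 * N" by (simp_all add: nsmul_add)
      then show "x \<in> (\<lambda>k. nsmul k p) ` {..3 * N}" by blast
    qed
    then have "card (sumset3 L) \<le> card {..3 * N}"
      by (meson card_image_le card_mono finite_atMost finite_imageI order_trans)
    then have "card (sumset3 L) \<le> 3 * card L" using card by simp
    moreover have "sumset3 L \<subseteq> V" using sub W(3)[OF p(1)] by auto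
    moreover have "0 \<in> L" unfolding L_def by (force intro: image_eqI[of _ _ 0])
    moreover have "finite L" unfolding L_def by simp
    ultimately show ?thesis using card by (intro exI[of _ L]) auto
  next
    case False
    have "nsmul (fact N) p = 0" if p: "p \<in> W" for p
    proof -
      obtain k where k: "1 \<le> k" "k \<le> N" "nsmul k p = 0" using False p by fastforce
      then have "k dvd fact N" by (simp add: dvd_fact)
      then obtain j where "fact N = j * k" by (metis dvd_div_mult_self)
      then show ?thesis using k(3) by (simp add: nsmul_mult)
    qed
    then have "\<exists>L. finite L \<and> 0 \<in> L \<and> N \<le> card L \<and> L \<subseteq> V \<and> (\<forall>a\<in>L. \<forall>b\<in>L. a + b \<in> L)"
      by (intro large_finite_subgroup_in_neighbourhood[OF nondiscrete W(1,2) _ _ V, of "fact N"])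
        simp_all
    then obtain L where L: "finite L" "0 \<in> L" "N \<le> card L" "L \<subseteq> V"
        "\<forall>a\<in>L. \<forall>b\<in>L. a + b \<in> L"
      by blast
    have "sumset3 L \<subseteq> L" unfolding sumset3_def using L(5) by auto
    moreover from this have "card (sumset3 L) \<le> card L" using L(1) card_mono by blast
    ultimately show ?thesis using L(1-4) by (intro exI[of _ L]) auto
  qed
qed

section \<open>Partial homomorphisms\<close>

definition partial_hom_on :: "'a::ab_group_add set \<Rightarrow> ('a \<Rightarrow> 'b::ab_group_add) \<Rightarrow> bool" where
  "partial_hom_on S \<phi> \<longleftrightarrow> (\<forall>u\<in>S. \<forall>v\<in>S. u + v \<in> S \<longrightarrow> \<phi> (u + v) = \<phi> u + \<phi> v)"

text \<open>Double counting of the pairs \<open>(q, y)\<close> with \<open>q\<close> in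
  \<open>S y\<close>. It limits how many points can lie in many of the sets.\<close>

lemma sum_card_occurrences_le:
  assumes "finite Y" "finite F" "\<And>y. y \<in> Y \<Longrightarrow> finite (S y) \<and> card (S y) \<le> m"
  shows "(\<Sum>q\<in>F. card {y\<in>Y. q \<in> S y}) \<le> m * card Y"
proof -
  have "(\<Sum>q\<in>F. card {y\<in>Y. q \<in> S y}) = (\<Sum>q\<in>F. \<Sum>y\<in>Y. of_bool (q \<in> S y))"
    using assms(1) by (simp add: sum.If_cases of_bool_def Int_def)
  also have "\<dots> = (\<Sum>y\<in>Y. \<Sum>q\<in>F. of_bool (q \<in> S y))" by (rule sum.swap)
  also have "\<dots> \<le> (\<Sum>y\<in>Y. m)"
  proof (rule sum_mono)
    fix y assume y: "y \<in> Y"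
    have "(\<Sum>q\<in>F. of_bool (q \<in> S y)) = card (F \<inter> S y)"
      using assms(2) by (simp add: sum.If_cases of_bool_def Int_def)
    also have "\<dots> \<le> card (S y)" using assms(3)[OF y] by (intro card_mono) auto
    finally show "(\<Sum>q\<in>F. of_bool (q \<in> S y)) \<le> m" using assms(3)[OF y] by linarith
  qed
  finally show ?thesis by (simp add: mult.commute)
qed

text \<open>Pigeonhole on types. Once \<open>S x\<close> is enumerated, its type records the index
  of \<open>x\<close>, the additive relations among the indices and the indices at which the points
  of \<open>F\<close> sit. The three factors of the bound count these choices. Two points of
  \<open>X\<close> with the same type give the map that subtracts each \<open>u\<close> from its
  counterpart.\<close>

lemma partial_hom_vanishing_on_root:
  fixes S :: "'a::ab_group_add \<Rightarrow> 'a set"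
  assumes S: "\<And>x. x \<in> X \<Longrightarrow> finite (S x) \<and> card (S x) \<le> m \<and> x \<in> S x"
    and F: "finite F" and X: "m * (2 ^ (m * (m * m)) * 2 ^ (m * card F)) < card X"
  shows "\<exists>x\<in>X. \<exists>\<phi> :: 'a \<Rightarrow> 'a. partial_hom_on (S x) \<phi> \<and> \<phi> x \<noteq> 0 \<and> (\<forall>u\<in>S x \<inter> F. \<phi> u = 0)"
proof -
  have "\<exists>e. x \<in> X \<longrightarrow> bij_betw e {..<card (S x)} (S x)" for x
    using S[of x] ex_bij_betw_nat_finite[of "S x"] by (auto simp: lessThan_atLeast0)
  then obtain e where e: "\<And>x. x \<in> X \<Longrightarrow> bij_betw (e x) {..<card (S x)} (S x)" by metis
  have "\<exists>j. x \<in> X \<longrightarrow> j < card (S x) \<and> e x j = x" for x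
    using S[of x] e[of x] unfolding bij_betw_def by force
  then obtain j where j: "\<And>x. x \<in> X \<Longrightarrow> j x < card (S x) \<and> e x (j x) = x" by metis
  define R where "R x = {(i, k, l). i < card (S x) \<and> k < card (S x) \<and> l < card (S x) \<and>
    e x i + e x k = e x l}" for x
  define P where "P x = {(i, q). i < card (S x) \<and> q \<in> F \<and> e x i = q}" for x
  define T where "T = {..<m} \<times> Pow ({..<m} \<times> {..<m} \<times> {..<m}) \<times> Pow ({..<m} \<times> F)"
  have T_card: "card T = m * (2 ^ (m * (m * m)) * 2 ^ (m * card F))"
    using F unfolding T_def by (simp add: card_cartesian_product card_Pow)
  have T_fin: "finite T" using F unfolding T_def by simp
  have T_img: "(\<lambda>x. (j x, R x, P x)) ` X \<subseteq> T"
  proof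
    fix c assume "c \<in> (\<lambda>x. (j x, R x, P x)) ` X"
    then obtain x where x: "x \<in> X" "c = (j x, R x, P x)" by auto
    then have "card (S x) \<le> m" "j x < card (S x)" using S j by auto
    then show "c \<in> T" unfolding x(2) T_def R_def P_def by auto
  qed
  have "\<not> inj_on (\<lambda>x. (j x, R x, P x)) X"
    using card_inj_on_le[OF _ T_img T_fin] T_card X by linarith
  then obtain x x' where x: "x \<in> X" "x' \<in> X" "x \<noteq> x'" "j x = j x'" "R x = R x'" "P x = P x'"
    unfolding inj_on_def by blast
  define n where "n = card (S x)"
  define r where "r = inv_into {..<n} (e x)"
  have r: "r u < n" "e x (r u) = u" if "u \<in> S x" for u
    using e[OF x(1)] that inv_into_into[of u "e x" "{..<n}"] f_inv_into_f[of u "e x" "{..<n}"]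
    unfolding r_def n_def bij_betw_def by auto
  have r_j: "r x = j x"
    using e[OF x(1)] j[OF x(1)] inv_into_f_f[of "e x" "{..<n}" "j x"]
    unfolding r_def n_def bij_betw_def by auto
  \<comment> \<open>The two sets may differ in size. An index beyond the end of \<open>S x'\<close>
    occurs in no relation of \<open>R x'\<close> and no pair of \<open>P x'\<close>, hence in none
    for \<open>x\<close>, so the unspecified value of \<open>e x'\<close> there does no
    harm.\<close>
  define \<phi> where "\<phi> u = e x' (r u) - u" for u
  have "partial_hom_on (S x) \<phi>"
    unfolding partial_hom_on_def
  proof (intro ballI impI)
    fix u v assume uv: "u \<in> S x" "v \<in> S x" "u + v \<in> S x"
    then have "(r u, r v, r (u + v)) \<in> R x" using r unfolding R_def n_def by simp
    then have "(r u, r v, r (u + v)) \<in> R x'" using x(5) by simp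
    then have "e x' (r u) + e x' (r v) = e x' (r (u + v))" unfolding R_def by simp
    then show "\<phi> (u + v) = \<phi> u + \<phi> v" unfolding \<phi>_def by (simp add: algebra_simps)
  qed
  moreover have "\<phi> x \<noteq> 0"
    using j[OF x(2)] x(3,4) r_j unfolding \<phi>_def by simp
  moreover have "\<phi> u = 0" if u: "u \<in> S x \<inter> F" for u
  proof -
    have "(r u, u) \<in> P x" using r u unfolding P_def n_def by simp
    then have "(r u, u) \<in> P x'" using x(6) by simp
    then show ?thesis unfolding P_def \<phi>_def by simp
  qed
  ultimately show ?thesis using x(1) by blast
qed

text \<open>The exponent \<open>12 * m * m\<close> bounds the number of points that lie in at least a fraction \<open>1 / (4 * m)\<close>
  of the sets.\<close>

definition tripling_bound :: "nat \<Rightarrow> nat" where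
  "tripling_bound m = Suc (m * (2 ^ (m * (m * m)) * 2 ^ (m * (12 * m * m))))"

text \<open>Double counting shows that \<open>F\<close>, the points lying in at least
  \<open>card L / (4 * m)\<close> of the sets, has at most \<open>12 * m * m\<close> elements, so
  pigeonhole over \<open>F\<close> yields \<open>x\<close> and \<open>\<phi>\<close>. A point
  outside \<open>F\<close> lies in \<open>S (c + t)\<close> for fewer than
  \<open>card L / (4 * m)\<close> of the \<open>t\<close>, and \<open>S x\<close> has at most
  \<open>m\<close> points, so at most a quarter of \<open>L\<close> is bad for a given
  \<open>c\<close>. The choice of \<open>s\<close> has to avoid one bad set, that of
  \<open>t\<close> two.\<close>

lemma partial_hom_vanishing_on_parallelogram:
  fixes S :: "'a::ab_group_add \<Rightarrow> 'a set"
  assumes L: "finite L" "0 \<in> L" "tripling_bound m \<le> card L" "card (sumset3 L) \<le> 3 * card L"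
    and Y: "Y = (+) x0 ` sumset3 L"
    and S: "\<And>y. y \<in> Y \<Longrightarrow> finite (S y) \<and> card (S y) \<le> m \<and> y \<in> S y"
  shows "\<exists>x s t. \<exists>\<phi> :: 'a \<Rightarrow> 'a. {x, x + s, x + t, x + s + t} \<subseteq> Y \<and> partial_hom_on (S x) \<phi> \<and>
    \<phi> x \<noteq> 0 \<and> (\<forall>u \<in> S x \<inter> (S (x + s) \<union> S (x + t) \<union> S (x + s + t)). \<phi> u = 0)"
proof -
  define occ where "occ q = card {y\<in>Y. q \<in> S y}" for q
  define F where "F = {q. card L \<le> 4 * m * occ q}"
  have L_pos: "card L > 0" using L(1,2) card_gt_0_iff by blast
  have Y_fin: "finite Y" using L(1) Y by simp
  have Y_card: "card Y \<le> 3 * card L"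
    using card_image_le[of "sumset3 L" "(+) x0"] L(1,4) Y by simp
  have Y_in: "x0 + (a + b + c) \<in> Y" if "a \<in> L" "b \<in> L" "c \<in> L" for a b c
    using that sumset3I Y by blast
  have "F \<subseteq> (\<Union>y\<in>Y. S y)"
  proof
    fix q assume "q \<in> F"
    then have "occ q \<noteq> 0" using L_pos unfolding F_def by (intro notI) simp
    then have "{y\<in>Y. q \<in> S y} \<noteq> {}" unfolding occ_def by force
    then show "q \<in> (\<Union>y\<in>Y. S y)" by auto
  qed
  then have F_fin: "finite F" using Y_fin S by (meson finite_UN_I finite_subset)
  have "card L * card F \<le> (\<Sum>q\<in>F. 4 * m * occ q)"
    using sum_mono[of F "\<lambda>_. card L" "\<lambda>q. 4 * m * occ q"] unfolding F_def
    by (simp add: mult.commute)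
  also have "\<dots> = 4 * m * (\<Sum>q\<in>F. occ q)" by (simp add: sum_distrib_left)
  also have "\<dots> \<le> 4 * m * (m * card Y)"
    using sum_card_occurrences_le[OF Y_fin F_fin, of S m] S unfolding occ_def by simp
  also have "\<dots> \<le> 4 * m * (m * (3 * card L))" using Y_card by simp
  also have "\<dots> = card L * (12 * m * m)" by simp
  finally have F_card: "card F \<le> 12 * m * m" using L_pos by simp
  have "m * (2 ^ (m * (m * m)) * 2 ^ (m * card F)) \<le> m * (2 ^ (m * (m * m)) * 2 ^ (m * (12 * m * m)))"
    using F_card by (intro mult_le_mono power_increasing) auto
  also have "\<dots> < card ((+) x0 ` L)"
    using L(3) unfolding tripling_bound_def by (simp add: card_image)
  finally have large: "m * (2 ^ (m * (m * m)) * 2 ^ (m * card F)) < card ((+) x0 ` L)" .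
  have sub: "(+) x0 ` L \<subseteq> Y" using Y_in[OF _ L(2) L(2)] by auto
  have "\<exists>x\<in>(+) x0 ` L. \<exists>\<phi> :: 'a \<Rightarrow> 'a. partial_hom_on (S x) \<phi> \<and> \<phi> x \<noteq> 0 \<and>
      (\<forall>u\<in>S x \<inter> F. \<phi> u = 0)"
    by (rule partial_hom_vanishing_on_root[OF _ F_fin large]) (use S sub in blast)
  then obtain x \<phi> where x: "x \<in> (+) x0 ` L" and \<phi>: "partial_hom_on (S x) \<phi>" "\<phi> x \<noteq> 0"
      "\<And>u. u \<in> S x \<inter> F \<Longrightarrow> \<phi> u = (0 :: 'a)"
    by blast
  obtain a where a: "a \<in> L" "x = x0 + a" using x by auto
  have x_Y: "x \<in> Y" using Y_in[OF a(1) L(2) L(2)] a(2) by simp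
  define bad where "bad c = {t\<in>L. \<not> S x \<inter> S (c + t) \<subseteq> F}" for c
  have bad_card: "4 * card (bad c) \<le> card L" if c: "\<And>t. t \<in> L \<Longrightarrow> c + t \<in> Y" for c
  proof (cases "m = 0")
    case True
    then have False using S[OF x_Y] by auto
    then show ?thesis ..
  next
    case False
    have le: "card {t\<in>L. q \<in> S (c + t)} \<le> occ q" for q
      unfolding occ_def using c Y_fin
      by (intro card_inj_on_le[of "(+) c"]) auto
    have one: "4 * m * card {t\<in>L. q \<in> S (c + t)} \<le> card L" if "q \<notin> F" for q
    proof -
      have "4 * m * occ q < card L" using that unfolding F_def by simp
      moreover have "4 * m * card {t\<in>L. q \<in> S (c + t)} \<le> 4 * m * occ q"
        using le[of q] by (rule mult_le_mono2)
      ultimately show ?thesis by linarith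
    qed
    have "bad c \<subseteq> (\<Union>q\<in>S x - F. {t\<in>L. q \<in> S (c + t)})" unfolding bad_def by auto
    then have "card (bad c) \<le> card (\<Union>q\<in>S x - F. {t\<in>L. q \<in> S (c + t)})"
      using L(1) S[OF x_Y] by (intro card_mono) auto
    also have "\<dots> \<le> (\<Sum>q\<in>S x - F. card {t\<in>L. q \<in> S (c + t)})"
      using S[OF x_Y] by (intro card_UN_le) auto
    finally have "4 * m * card (bad c) \<le> (\<Sum>q\<in>S x - F. 4 * m * card {t\<in>L. q \<in> S (c + t)})"
      by (simp add: sum_distrib_left[symmetric])
    also have "\<dots> \<le> (\<Sum>q\<in>S x - F. card L)" using one by (intro sum_mono) auto
    also have "\<dots> = card (S x - F) * card L" by simp
    also have "\<dots> \<le> m * card L"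
      using S[OF x_Y] card_mono[of "S x" "S x - F"] by (intro mult_le_mono1) auto
    finally show ?thesis using False by (simp add: mult.assoc mult.left_commute[of 4])
  qed
  have bad_fin: "finite (bad c)" for c unfolding bad_def using L(1) by simp
  have c1: "x + t \<in> Y" if "t \<in> L" for t
    using Y_in[OF a(1) that L(2)] a(2) by (simp add: add.assoc)
  have "\<exists>s\<in>L. s \<notin> bad x"
  proof (rule ccontr)
    assume "\<not> (\<exists>s\<in>L. s \<notin> bad x)"
    then have "card L \<le> card (bad x)" by (intro card_mono bad_fin) auto
    then show False using bad_card[OF c1] L_pos by simp
  qed
  then obtain s where s: "s \<in> L" "s \<notin> bad x" by blast
  have c2: "x + s + t \<in> Y" if "t \<in> L" for t
    using Y_in[OF a(1) s(1) that] a(2) by (simp add: add.assoc)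
  have "\<exists>t\<in>L. t \<notin> bad x \<union> bad (x + s)"
  proof (rule ccontr)
    assume "\<not> (\<exists>t\<in>L. t \<notin> bad x \<union> bad (x + s))"
    then have "card L \<le> card (bad x \<union> bad (x + s))" by (intro card_mono finite_UnI bad_fin) auto
    also have "\<dots> \<le> card (bad x) + card (bad (x + s))" by (rule card_Un_le)
    finally show False using bad_card[OF c1] bad_card[OF c2] L_pos by simp
  qed
  then obtain t where t: "t \<in> L" "t \<notin> bad x" "t \<notin> bad (x + s)" by blast
  have "S x \<inter> (S (x + s) \<union> S (x + t) \<union> S (x + s + t)) \<subseteq> S x \<inter> F"
    using s t unfolding bad_def by blast
  then have "\<forall>u \<in> S x \<inter> (S (x + s) \<union> S (x + t) \<union> S (x + s + t)). \<phi> u = 0"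
    using \<phi>(3) by blast
  moreover have "{x, x + s, x + t, x + s + t} \<subseteq> Y" using x_Y c1 c2 s(1) t(1) by simp
  ultimately show ?thesis using \<phi>(1,2) by blast
qed

section \<open>Reduction to countably many values\<close>

text \<open>Only countably many patterns of additive relations on a finite set exist, so one solution of each
  solvable pattern gives a countable set of values.\<close>

definition separating_range :: "'a::ab_group_add set \<Rightarrow> bool" where
  "separating_range D \<longleftrightarrow> 0 \<in> D \<and> (\<forall>S Q x. \<forall>\<phi> :: 'a \<Rightarrow> 'a. finite S \<and> x \<in> S \<and> partial_hom_on S \<phi> \<and>
     \<phi> x \<noteq> 0 \<and> (\<forall>u\<in>S \<inter> Q. \<phi> u = 0) \<longrightarrow>
     (\<exists>\<psi> :: 'a \<Rightarrow> 'a. partial_hom_on S \<psi> \<and> \<psi> x \<noteq> 0 \<and> (\<forall>u\<in>S \<inter> Q. \<psi> u = 0) \<and> \<psi> ` S \<subseteq> D))"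

lemma countable_separating_range:
  "\<exists>D :: 'a::ab_group_add set. countable D \<and> separating_range D"
proof -
  define sol :: "nat \<Rightarrow> nat list \<Rightarrow> (nat \<times> nat \<times> nat) list \<Rightarrow> (nat \<Rightarrow> 'a) \<Rightarrow> bool" where
    "sol j Zs R v \<longleftrightarrow> v j \<noteq> 0 \<and> (\<forall>i\<in>set Zs. v i = 0) \<and> (\<forall>(i, k, l)\<in>set R. v i + v k = v l)" for j Zs R v
  \<comment> \<open>One solution is chosen for each pattern: the index that must not vanish, the
    indices that must, and the relations. The patterns are countable in number and each solution is
    a sequence, so \<open>D\<close> is countable. The extra 0 serves for extending maps by
    0.\<close>
  define c where "c = (\<lambda>(j, Zs, R). SOME v. sol j Zs R v)"
  define D where "D = insert 0 (range (\<lambda>(p, i). c p i))"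
  have "separating_range D"
    unfolding separating_range_def
  proof (intro conjI allI impI)
    show "0 \<in> D" unfolding D_def by simp
    fix S Q :: "'a set" and x and \<phi> :: "'a \<Rightarrow> 'a"
    assume "finite S \<and> x \<in> S \<and> partial_hom_on S \<phi> \<and> \<phi> x \<noteq> 0 \<and> (\<forall>u\<in>S \<inter> Q. \<phi> u = 0)"
    then have S: "finite S" "x \<in> S"
      and \<phi>: "partial_hom_on S \<phi>" "\<phi> x \<noteq> 0" "\<forall>u\<in>S \<inter> Q. \<phi> u = 0"
      by blast+
    define n where "n = card S"
    obtain e where e: "bij_betw e {..<n} S"
      using ex_bij_betw_nat_finite[OF S(1)] unfolding n_def by (auto simp: lessThan_atLeast0)
    define r where "r = inv_into {..<n} e"
    have r: "r u < n" "e (r u) = u" if "u \<in> S" for u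
      using e that inv_into_into[of u e "{..<n}"] f_inv_into_f[of u e "{..<n}"]
      unfolding r_def bij_betw_def by auto
    have eS: "e i \<in> S" if "i < n" for i using e that unfolding bij_betw_def by auto
    obtain Zs where Zs: "set Zs = {i. i < n \<and> e i \<in> Q}"
      using finite_list[of "{i. i < n \<and> e i \<in> Q}"] by auto
    have "finite ({..<n} \<times> {..<n} \<times> {..<n})" by simp
    then have "finite {(i, k, l). i < n \<and> k < n \<and> l < n \<and> e i + e k = e l}"
      by (rule finite_subset[rotated]) auto
    then obtain R where R: "set R = {(i, k, l). i < n \<and> k < n \<and> l < n \<and> e i + e k = e l}"
      using finite_list by blast
    \<comment> \<open>Read through the enumeration, \<open>\<phi>\<close> itself solves the pattern.
      The solution selected in advance therefore solves it too, and its values lie in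
      \<open>D\<close>.\<close>
    have "sol (r x) Zs R (\<lambda>i. \<phi> (e i))"
      unfolding sol_def Zs R
    proof (intro conjI ballI)
      show "\<phi> (e (r x)) \<noteq> 0" using r S(2) \<phi>(2) by simp
      show "\<phi> (e i) = 0" if "i \<in> {i. i < n \<and> e i \<in> Q}" for i using that eS \<phi>(3) by auto
      show "case p of (i, k, l) \<Rightarrow> \<phi> (e i) + \<phi> (e k) = \<phi> (e l)"
        if prem: "p \<in> {(i, k, l). i < n \<and> k < n \<and> l < n \<and> e i + e k = e l}" for p
      proof -
        obtain i k l where p: "p = (i, k, l)" "i < n" "k < n" "l < n" "e i + e k = e l"
          using prem by auto
        then have "\<phi> (e i + e k) = \<phi> (e i) + \<phi> (e k)"
          using \<phi>(1) eS unfolding partial_hom_on_def by metis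
        then show ?thesis using p by simp
      qed
    qed
    then have c: "sol (r x) Zs R (c (r x, Zs, R))" 
      unfolding c_def by (simp add: someI[of "sol (r x) Zs R"])
    define \<psi> where "\<psi> u = c (r x, Zs, R) (r u)" for u
    have "partial_hom_on S \<psi>"
      unfolding partial_hom_on_def
    proof (intro ballI impI)
      fix u v assume "u \<in> S" "v \<in> S" "u + v \<in> S"
      then have "(r u, r v, r (u + v)) \<in> set R" unfolding R using r by simp
      then show "\<psi> (u + v) = \<psi> u + \<psi> v" using c unfolding sol_def \<psi>_def by fastforce
    qed
    moreover have "\<psi> x \<noteq> 0" using c unfolding sol_def \<psi>_def by simp
    moreover have "\<forall>u\<in>S \<inter> Q. \<psi> u = 0"
    proof
      fix u assume "u \<in> S \<inter> Q"
      then have "r u \<in> set Zs" unfolding Zs using r by simp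
      then show "\<psi> u = 0" using c unfolding sol_def \<psi>_def by simp
    qed
    moreover have "\<psi> ` S \<subseteq> D" unfolding D_def \<psi>_def by force
    ultimately show "\<exists>\<psi>. partial_hom_on S \<psi> \<and> \<psi> x \<noteq> 0 \<and> (\<forall>u\<in>S \<inter> Q. \<psi> u = 0) \<and> \<psi> ` S \<subseteq> D"
      by blast
  qed
  moreover have "countable D" unfolding D_def by simp
  ultimately show ?thesis by blast
qed

section \<open>Interpolation by locally constant functions\<close>

text \<open>A decision list over open sets, coded by pairs of indices. The codes are finite lists of
  naturals, so only countably many functions arise.\<close>

primrec first_hit :: "(nat \<Rightarrow> 'a set) \<Rightarrow> (nat \<Rightarrow> 'b::zero) \<Rightarrow> (nat \<times> nat) list \<Rightarrow> 'a \<Rightarrow> 'b" where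
  "first_hit B d [] x = 0"
| "first_hit B d (p # ps) x = (if x \<in> B (fst p) then d (snd p) else first_hit B d ps x)"

definition no_jump :: "(nat \<Rightarrow> 'a::topological_space set) \<Rightarrow> (nat \<times> nat) list \<Rightarrow> 'a set" where
  "no_jump B ps = - (\<Union>p\<in>set ps. frontier (B (fst p)))"

lemma open_no_jump: "open (no_jump B ps)"
  unfolding no_jump_def by (intro open_Compl closed_UN) auto

lemma first_hit_measurable:
  assumes "\<And>i. open (B i)"
  shows "first_hit B d ps \<in> borel_measurable borel"
proof (induction ps)
  case (Cons p ps)
  have "{x \<in> space borel. x \<in> B (fst p)} \<in> sets borel" using assms by simp
  then have "(\<lambda>x. if x \<in> B (fst p) then d (snd p) else first_hit B d ps x) \<in> borel_measurable borel"
    using Cons by (intro measurable_If) auto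
  then show ?case by simp
qed simp

text \<open>Away from the frontier, a point outside the open set \<open>B (fst p)\<close> is also
  outside its closure, so a whole neighbourhood skips this entry of the list.\<close>

lemma first_hit_locally_constant:
  assumes "\<And>i. open (B i)" "x \<in> no_jump B ps"
  shows "\<exists>U. open U \<and> x \<in> U \<and> (\<forall>y\<in>U. first_hit B d ps y = first_hit B d ps x)"
  using assms(2)
proof (induction ps)
  case Nil
  then show ?case by (intro exI[of _ UNIV]) simp
next
  case (Cons p ps)
  show ?case
  proof (cases "x \<in> B (fst p)")
    case True
    then show ?thesis using assms(1) by (intro exI[of _ "B (fst p)"]) simp
  next
    case False
    have "x \<in> no_jump B ps" using Cons.prems unfolding no_jump_def by simp
    then obtain U where U: "open U" "x \<in> U" "\<forall>y\<in>U. first_hit B d ps y = first_hit B d ps x"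
      using Cons.IH by blast
    have "x \<notin> closure (B (fst p))"
      using Cons.prems False assms(1)[of "fst p"] unfolding no_jump_def frontier_def
      by (simp add: interior_open)
    then have x: "x \<in> U - closure (B (fst p))" using U(2) by simp
    have "first_hit B d (p # ps) y = first_hit B d (p # ps) x" if "y \<in> U - closure (B (fst p))" for y
    proof -
      have "y \<notin> B (fst p)" using that closure_subset by blast
      then show ?thesis using U(3) that False by simp
    qed
    moreover have "open (U - closure (B (fst p)))" using U(1) by (intro open_Diff) auto
    ultimately show ?thesis using x by blast
  qed
qed

text \<open>\<open>T\<close> is the set of all points to be controlled, \<open>S\<close> the part
  where a value other than the default 0 may be prescribed. The induction puts at the head of the
  list a basic neighbourhood of \<open>u\<close> whose closure misses the rest of \<open>T\<close>.
  This entry overrides the value 0 that the tail has at \<open>u\<close>.\<close>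

lemma first_hit_interpolates:
  fixes B :: "nat \<Rightarrow> 'a::metric_space set"
  assumes B: "topological_basis (range B)" and "finite S" "finite T" "S \<subseteq> T" "\<phi> ` S \<subseteq> range d"
    "\<phi> ` (T - S) \<subseteq> {0}"
  shows "\<exists>ps. T \<subseteq> no_jump B ps \<and> (\<forall>u\<in>T. first_hit B d ps u = \<phi> u)"
  using assms(2-)
proof (induction S arbitrary: \<phi> rule: finite_induct)
  case empty
  then show ?case by (intro exI[of _ "[]"]) (auto simp: no_jump_def)
next
  case (insert u S)
  obtain ps where ps: "T \<subseteq> no_jump B ps" "\<forall>v\<in>T. first_hit B d ps v = (\<phi>(u := 0)) v"
    using insert.IH[of "\<phi>(u := 0)"] insert.prems insert.hyps(2) by fastforce
  obtain j where j: "\<phi> u = d j" using insert.prems(3) by auto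
  have "open (- (T - {u}))" using insert.prems(1) by (intro open_Compl finite_imp_closed) simp
  then obtain e where e: "e > 0" "cball u e \<subseteq> - (T - {u})"
    by (metis Compl_iff DiffE insertI1 open_contains_cball)
  obtain i where i: "u \<in> B i" "B i \<subseteq> ball u e"
    using topological_basisE[OF B open_ball[of u e], of u] e(1) by auto
  have "closure (B i) \<subseteq> cball u e"
    using i(2) ball_subset_cball by (intro closure_minimal) auto
  then have cl: "closure (B i) \<inter> T \<subseteq> {u}" using e(2) by blast
  have "open (B i)" using B topological_basis_open by blast
  then have "frontier (B i) \<inter> T = {}"
    using cl i(1) unfolding frontier_def by (auto simp: interior_open)
  then have "T \<subseteq> no_jump B ((i, j) # ps)" using ps(1) unfolding no_jump_def by auto
  moreover have "first_hit B d ((i, j) # ps) v = \<phi> v" if "v \<in> T" for v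
  proof (cases "v = u")
    case False
    then have "v \<notin> B i" using cl that closure_subset[of "B i"] by auto
    then show ?thesis using ps(2) that False by simp
  qed (use i(1) j in simp)
  ultimately show ?case by blast
qed

lemma locally_constant_interpolating_family:
  fixes D :: "'b::{zero, topological_space} set"
  assumes D: "countable D" "0 \<in> D"
  obtains f :: "nat \<Rightarrow> 'a::{metric_space, second_countable_topology} \<Rightarrow> 'b" and R where
    "\<And>a. open (R a)" "\<And>a. f a \<in> borel_measurable borel"
    "\<And>a x. x \<in> R a \<Longrightarrow> \<exists>U. open U \<and> x \<in> U \<and> (\<forall>y\<in>U. f a y = f a x)"
    "\<And>S \<phi>. finite S \<Longrightarrow> \<phi> ` S \<subseteq> D \<Longrightarrow> \<exists>a. S \<subseteq> R a \<and> (\<forall>u\<in>S. f a u = \<phi> u)"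
proof -
  obtain \<B> :: "'a set set" where \<B>: "countable \<B>" "topological_basis \<B>"
    using ex_countable_basis by auto
  have "\<B> \<noteq> {}"
    using topological_basisE[OF \<B>(2) open_UNIV UNIV_I] by blast
  then have range_B: "range (from_nat_into \<B>) = \<B>" using \<B>(1) by (rule range_from_nat_into)
  have range_d: "range (from_nat_into D) = D" using D by (intro range_from_nat_into) auto
  define B where "B = from_nat_into \<B>"
  define d where "d = from_nat_into D"
  have B: "topological_basis (range B)" using \<B>(2) range_B unfolding B_def by simp
  have open_B: "open (B i)" for i using B topological_basis_open by blast
  show ?thesis
  proof
    show "open (no_jump B (from_nat a))" for a by (rule open_no_jump)
    show "first_hit B d (from_nat a) \<in> borel_measurable borel" for a
      by (rule first_hit_measurable[OF open_B])
    show "\<exists>U. open U \<and> x \<in> U \<and> (\<forall>y\<in>U. first_hit B d (from_nat a) y = first_hit B d (from_nat a) x)"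
      if "x \<in> no_jump B (from_nat a)" for a x
      by (rule first_hit_locally_constant[OF open_B that])
    show "\<exists>a. S \<subseteq> no_jump B (from_nat a) \<and> (\<forall>u\<in>S. first_hit B d (from_nat a) u = \<phi> u)"
      if S: "finite S" "\<phi> ` S \<subseteq> D" for S \<phi>
    proof -
      obtain ps where "S \<subseteq> no_jump B ps" "\<forall>u\<in>S. first_hit B d ps u = \<phi> u"
        using first_hit_interpolates[OF B S(1) S(1), of \<phi> d] S(2) range_d unfolding d_def by auto
      then show ?thesis by (intro exI[of _ "to_nat ps"]) simp
    qed
  qed
qed

section \<open>Codes for analytic sets\<close>

lemma second_countable_euclidean: "second_countable (euclidean :: 'x::second_countable_topology topology)"
proof -
  obtain \<B> :: "'x set set" where \<B>: "countable \<B>" "topological_basis \<B>"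
    using ex_countable_basis by auto
  have "\<exists>V\<in>\<B>. x \<in> V \<and> V \<subseteq> U" if "open U" "x \<in> U" for U and x :: 'x
    using topological_basisE[OF \<B>(2) that] by metis
  then show ?thesis
    using \<B>(1) topological_basis_open[OF \<B>(2)] unfolding second_countable_def
    by (intro exI[of _ \<B>]) auto
qed

lemma Polish_topology_pullback:
  fixes C :: "'x::{complete_space, second_countable_topology} set" and i :: "'x \<Rightarrow> 'y"
  assumes C: "closed C" and i: "inj_on i C"
  defines "T \<equiv> pullback_topology (i ` C) (inv_into C i) (top_of_set C)"
  shows "Polish_topology T" and "topspace T = i ` C" and "continuous_map T (top_of_set C) (inv_into C i)"
proof -
  show top: "topspace T = i ` C"
    unfolding T_def topspace_pullback_topology by (auto intro: inv_into_into)
  show cont: "continuous_map T (top_of_set C) (inv_into C i)"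
    using continuous_map_pullback[OF continuous_map_id] unfolding T_def by simp
  have "homeomorphic_maps T (top_of_set C) (inv_into C i) i"
    unfolding homeomorphic_maps_def
  proof (intro conjI ballI cont)
    show "continuous_map (top_of_set C) T i"
      unfolding T_def
    proof (rule continuous_map_pullback')
      show "continuous_map (top_of_set C) (top_of_set C) (inv_into C i \<circ> i)"
        by (rule continuous_map_eq[OF continuous_map_id]) (simp add: i)
    qed auto
    show "i (inv_into C i x) = x" if "x \<in> topspace T" for x
      using that unfolding top by (rule f_inv_into_f)
    show "inv_into C i (i x) = x" if "x \<in> topspace (top_of_set C)" for x
      using that i by simp
  qed
  then have hom: "T homeomorphic_space top_of_set C" unfolding homeomorphic_space_def by blast
  have "completely_metrizable_space (top_of_set C)"
    using C completely_metrizable_space_closedin[OF completely_metrizable_space_euclidean] by auto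
  moreover have "separable_space (top_of_set C)"
    by (intro second_countable_imp_separable_space second_countable_subtopology
        second_countable_euclidean)
  ultimately show "Polish_topology T"
    using homeomorphic_completely_metrizable_space[OF hom] homeomorphic_separable_space[OF hom]
    unfolding Polish_topology_def by blast
qed

text \<open>In a T0 space a point is determined by the basic open sets that contain it, hence by a
  set of naturals, and there are as many of these as reals.\<close>

lemma inj_into_reals: "\<exists>i :: 'x::{t0_space, second_countable_topology} \<Rightarrow> real. inj i"
proof -
  obtain \<B> :: "'x set set" where \<B>: "countable \<B>" "topological_basis \<B>"
    using ex_countable_basis by blast
  define c where "c x = to_nat_on \<B> ` {U\<in>\<B>. x \<in> U}" for x
  have "inj c"
  proof (rule injI, rule ccontr)
    fix x y assume c: "c x = c y" and "x \<noteq> y"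
    then obtain U where U: "open U" "(x \<in> U) \<noteq> (y \<in> U)"
      using separation_t0[of x y] by auto
    have "{U\<in>\<B>. x \<in> U} = {U\<in>\<B>. y \<in> U}"
      using c inj_on_image_eq_iff[OF inj_on_to_nat_on[OF \<B>(1)], of "{U\<in>\<B>. x \<in> U}" "{U\<in>\<B>. y \<in> U}"]
      unfolding c_def by simp
    moreover have "\<exists>W\<in>\<B>. z \<in> W \<and> W \<subseteq> U" if z: "z \<in> U" for z
    proof -
      obtain W where "W \<in> \<B>" "z \<in> W" "W \<subseteq> U"
        using topological_basisE[OF \<B>(2) U(1) z] .
      then show ?thesis by blast
    qed
    ultimately show False using U(2) by blast
  qed
  moreover obtain b :: "nat set \<Rightarrow> real" where "inj b"
    using nat_sets_eqpoll_reals unfolding eqpoll_def bij_betw_def by blast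
  ultimately have "inj (b \<circ> c)" by (simp add: inj_compose)
  then show ?thesis by blast
qed

lemma analytic_set_continuous_image:
  fixes C :: "'x::{complete_space, second_countable_topology} set"
  assumes C: "closed C" and h: "continuous_on C h"
  shows "analytic_set (h ` C)"
proof -
  obtain i :: "'x \<Rightarrow> real" where "inj i" using inj_into_reals by blast
  then have i: "inj_on i C" by (rule inj_on_subset) simp
  let ?T = "pullback_topology (i ` C) (inv_into C i) (top_of_set C)"
  note T = Polish_topology_pullback[OF C i]
  have "continuous_map ?T euclidean (h \<circ> inv_into C i)"
    using h by (intro continuous_map_compose[OF T(3)]) simp
  moreover have "(h \<circ> inv_into C i) ` topspace ?T = h ` C"
    unfolding T(2) using i by (force simp: image_image)
  ultimately show ?thesis using T(1) unfolding analytic_set_def by blast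
qed

lemma analytic_set_UN_continuous_images:
  fixes C :: "nat \<Rightarrow> 'x::{complete_space, second_countable_topology} set"
  assumes C: "\<And>m. closed (C m)" and h: "continuous_on (\<Union>m. C m) h"
  shows "analytic_set (\<Union>m. h ` C m)"
proof -
  define E :: "(real \<times> 'x) set" where
    \<comment> \<open>\<open>E\<close> is the disjoint union of the \<open>C m\<close>, with
      \<open>C m\<close> placed over the real number \<open>m\<close>. For each \<open>m\<close> the
      condition is that the first coordinate is another natural number or the second lies in
      \<open>C m\<close>. In this form both alternatives are closed.\<close>
    "E = (fst -` range real) \<inter> (\<Inter>m. fst -` (real ` (- {m})) \<union> snd -` C m)"
  have E: "(r, x) \<in> E \<longleftrightarrow> (\<exists>m. r = real m \<and> x \<in> C m)" for r x
    unfolding E_def by auto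
  have "closed E"
    unfolding E_def
    by (intro closed_Int closed_INT closed_Un ballI closed_vimage C closed_of_nat_image
        continuous_intros)
  moreover have "continuous_on E (h \<circ> snd)"
    using E by (intro continuous_on_compose continuous_intros continuous_on_subset[OF h]) auto
  ultimately have "analytic_set ((h \<circ> snd) ` E)" by (rule analytic_set_continuous_image)
  moreover have "(h \<circ> snd) ` E = (\<Union>m. h ` C m)"
    using E by (force simp: image_iff)
  ultimately show ?thesis by simp
qed

lemma compact_Pi_UNIV:
  fixes K :: "'i \<Rightarrow> 'a::topological_space set"
  assumes "\<And>i. compact (K i)"
  shows "compact {F. \<forall>i. F i \<in> K i}"
proof -
  have "compactin (product_topology (\<lambda>_. euclidean) UNIV) (PiE UNIV K)"
    using assms by (simp add: compactin_PiE)
  moreover have "PiE UNIV K = {F. \<forall>i. F i \<in> K i}" by (auto simp: PiE_def)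
  ultimately show ?thesis by (simp add: euclidean_product_topology)
qed

lemma compact_imp_closed_char_funs:
  fixes S :: "('i \<Rightarrow> bool) set"
  assumes "compact S"
  shows "closed S"
proof -
  have "Hausdorff_space (euclidean :: bool topology)"
    unfolding Hausdorff_space_def
  proof (intro allI impI)
    fix x y :: bool assume "x \<in> topspace euclidean \<and> y \<in> topspace euclidean \<and> x \<noteq> y"
    then show "\<exists>U V. openin euclidean U \<and> openin euclidean V \<and> x \<in> U \<and> y \<in> V \<and> disjnt U V"
      by (intro exI[of _ "{x}"] exI[of _ "{y}"]) (simp add: open_discrete)
  qed
  then have "Hausdorff_space (euclidean :: ('i \<Rightarrow> bool) topology)"
    unfolding euclidean_product_topology[symmetric] Hausdorff_space_product_topology
    by simp
  then have "closedin euclidean S" using assms by (intro compactin_imp_closedin) simp_all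
  then show ?thesis by simp
qed

text \<open>Real sequences of zeros and ones stand in for characteristic functions, so that codes
  live in a complete metric space. The translation is continuous because \<open>{0, 1}\<close> is
  finite, hence discrete.\<close>

lemma continuous_on_code_char_fun:
  "continuous_on ({b :: 'i \<Rightarrow> real. \<forall>i. b i \<in> {0, 1}} \<times> UNIV) (\<lambda>p i. fst p i = 1)"
proof (rule continuous_on_coordinatewise_then_product)
  fix i :: 'i
  show "continuous_on ({b :: 'i \<Rightarrow> real. \<forall>i. b i \<in> {0, 1}} \<times> UNIV) (\<lambda>p. fst p i = 1)"
  proof (rule continuous_on_compose2[of "{0, 1}" "\<lambda>r. r = 1"])
    show "continuous_on ({b :: 'i \<Rightarrow> real. \<forall>i. b i \<in> {0, 1}} \<times> UNIV) (\<lambda>p. fst p i)"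
      by (rule continuous_on_product_then_coordinatewise[OF continuous_on_fst[OF continuous_on_id]])
  qed (auto intro: continuous_on_finite)
qed

section \<open>The ideal of non-additivity\<close>

text \<open>The ideal and its complexity rest on these two properties alone. That the family is rich
  enough to interpolate enters only in \<open>not_approximable\<close>.\<close>

locale locally_constant_family =
  fixes f :: "nat \<Rightarrow> 'h::{polish_space, topological_ab_group_add} \<Rightarrow> 'h" and R :: "nat \<Rightarrow> 'h set"
  assumes open_R: "open (R a)"
    and locally_constant: "x \<in> R a \<Longrightarrow> \<exists>U. open U \<and> x \<in> U \<and> (\<forall>y\<in>U. f a y = f a x)"
begin

definition good :: "nat \<Rightarrow> 'h set \<Rightarrow> bool" where
  "good a S \<longleftrightarrow> S \<subseteq> R a \<and> partial_hom_on S (f a)"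

definition non_additivity_ideal :: "nat set set" where
  "non_additivity_ideal = {A. \<exists>S. finite S \<and> (\<forall>a\<in>A. \<not> good a S)}"

lemma good_subset: "good a T \<Longrightarrow> S \<subseteq> T \<Longrightarrow> good a S"
  unfolding good_def partial_hom_on_def by blast

lemma set_ideal_non_additivity: "set_ideal non_additivity_ideal"
  unfolding set_ideal_def
proof (intro conjI ballI allI impI)
  show "{} \<in> non_additivity_ideal" unfolding non_additivity_ideal_def by blast
  show "B \<in> non_additivity_ideal" if "A \<in> non_additivity_ideal" "B \<subseteq> A" for A B
    using that unfolding non_additivity_ideal_def by blast
  show "A \<union> B \<in> non_additivity_ideal"
    if AB: "A \<in> non_additivity_ideal" "B \<in> non_additivity_ideal" for A B
  proof -
    obtain S T where "finite S" "\<forall>a\<in>A. \<not> good a S" "finite T" "\<forall>a\<in>B. \<not> good a T"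
      using AB unfolding non_additivity_ideal_def by blast
    then show ?thesis
      unfolding non_additivity_ideal_def
      using good_subset[of _ "S \<union> T" S] good_subset[of _ "S \<union> T" T]
      by (intro CollectI exI[of _ "S \<union> T"]) auto
  qed
qed

lemma approximate_hom_family: "approximate_hom non_additivity_ideal (\<lambda>x a. f a x)"
  unfolding approximate_hom_def
proof (intro allI)
  fix x y
  have "\<forall>a\<in>{a. f a x + f a y \<noteq> f a (x + y)}. \<not> good a {x, y, x + y}"
    unfolding good_def partial_hom_on_def by auto
  then show "{a. f a x + f a y \<noteq> f a (x + y)} \<in> non_additivity_ideal"
    unfolding non_additivity_ideal_def by (intro CollectI exI[of _ "{x, y, x + y}"]) simp
qed

section \<open>Open and closed conditions on tuples\<close>

lemma open_vimage_coordinate: "open U \<Longrightarrow> open ((\<lambda>F :: nat \<Rightarrow> 'h. F i) -` U)"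
  by (intro open_vimage continuous_on_product_coordinates)

text \<open>Close to \<open>F\<close> the values of \<open>f a\<close> do not change. No new
  additive relation appears among the coordinates either, since
  \<open>F i + F j \<noteq> F k\<close> is an open condition.\<close>

lemma open_good: "open {F :: nat \<Rightarrow> 'h. good a (F ` {..<m})}"
proof (subst open_subopen, intro ballI)
  fix F :: "nat \<Rightarrow> 'h" assume "F \<in> {F. good a (F ` {..<m})}"
  then have F: "\<And>i. i < m \<Longrightarrow> F i \<in> R a"
    and hom: "\<And>i j k. i < m \<Longrightarrow> j < m \<Longrightarrow> k < m \<Longrightarrow> F i + F j = F k \<Longrightarrow> f a (F k) = f a (F i) + f a (F j)"
    unfolding good_def partial_hom_on_def by (blast, force)
  have "\<exists>U. i < m \<longrightarrow> open U \<and> F i \<in> U \<and> (\<forall>y\<in>U. f a y = f a (F i))" for i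
    using locally_constant[OF F] by blast
  then obtain U where U: "\<And>i. i < m \<Longrightarrow> open (U i) \<and> F i \<in> U i \<and> (\<forall>y\<in>U i. f a y = f a (F i))"
    by metis
  define T where "T = (\<Inter>i\<in>{..<m}. (\<lambda>G. G i) -` (U i \<inter> R a)) \<inter>
    (\<Inter>(i, j, k)\<in>{(i, j, k) \<in> {..<m} \<times> {..<m} \<times> {..<m}. F i + F j \<noteq> F k}. {G. G i + G j \<noteq> G k})"
  have "finite {(i, j, k) \<in> {..<m} \<times> {..<m} \<times> {..<m}. F i + F j \<noteq> F k}"
    by (rule finite_subset[of _ "{..<m} \<times> {..<m} \<times> {..<m}"]) auto
  moreover have "open {G :: nat \<Rightarrow> 'h. G i + G j \<noteq> G k}" for i j k
    by (intro open_Collect_neq continuous_on_add continuous_on_product_coordinates)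
  ultimately have "open T"
    unfolding T_def using U open_R
    by (intro open_Int open_INT ballI open_vimage_coordinate) auto
  moreover have "F \<in> T" unfolding T_def using U F by auto
  moreover have "T \<subseteq> {F. good a (F ` {..<m})}"
  proof
    fix G assume G: "G \<in> T"
    have Gi: "G i \<in> R a" "f a (G i) = f a (F i)" if "i < m" for i
    proof -
      have "G i \<in> U i \<inter> R a" using G that unfolding T_def by blast
      then show "G i \<in> R a" "f a (G i) = f a (F i)" using U[OF that] by blast+
    qed
    have "f a (G k) = f a (G i) + f a (G j)"
      if "i < m" "j < m" "k < m" "G i + G j = G k" for i j k
    proof -
      have "F i + F j = F k" using G that unfolding T_def by blast
      then show ?thesis using hom Gi(2) that by simp
    qed
    then have "partial_hom_on (G ` {..<m}) (f a)"
      unfolding partial_hom_on_def by force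
    then show "G \<in> {F. good a (F ` {..<m})}" using Gi(1) unfolding good_def by auto
  qed
  ultimately show "\<exists>T. open T \<and> F \<in> T \<and> T \<subseteq> {F. good a (F ` {..<m})}" by blast
qed

text \<open>A disagreement persists nearby, as \<open>f a\<close> is constant near
  \<open>F 0\<close> and \<open>g a\<close> is continuous. Coordinate 0 holds the point
  \<open>x\<close> in question, and the first \<open>Suc m\<close> coordinates list the finite set
  attached to it.\<close>

lemma closed_agreement:
  assumes g: "\<And>a. continuous_on UNIV (g a)"
  shows "closed {F :: nat \<Rightarrow> 'h. \<forall>a. good a (F ` {..<Suc m}) \<longrightarrow> f a (F 0) = g a (F 0)}"
proof -
  have "open {F :: nat \<Rightarrow> 'h. good a (F ` {..<Suc m}) \<and> f a (F 0) \<noteq> g a (F 0)}" for a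
  proof (subst open_subopen, intro ballI)
    fix F :: "nat \<Rightarrow> 'h" assume "F \<in> {F. good a (F ` {..<Suc m}) \<and> f a (F 0) \<noteq> g a (F 0)}"
    then have F: "good a (F ` {..<Suc m})" "f a (F 0) \<noteq> g a (F 0)" by auto
    then have "F 0 \<in> R a" unfolding good_def by auto
    then obtain U where U: "open U" "F 0 \<in> U" "\<forall>y\<in>U. f a y = f a (F 0)"
      using locally_constant by blast
    let ?T = "{F. good a (F ` {..<Suc m})} \<inter> (\<lambda>G. G 0) -` (U \<inter> {y. f a (F 0) \<noteq> g a y})"
    have "open ?T"
      using g U(1) by (intro open_Int open_good open_vimage_coordinate open_Collect_neq) auto
    moreover have "F \<in> ?T" using F U(2) by simp
    moreover have "?T \<subseteq> {F. good a (F ` {..<Suc m}) \<and> f a (F 0) \<noteq> g a (F 0)}" using U(3) by auto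
    ultimately show "\<exists>T. open T \<and> F \<in> T \<and>
        T \<subseteq> {F. good a (F ` {..<Suc m}) \<and> f a (F 0) \<noteq> g a (F 0)}" by blast
  qed
  then have "closed (\<Inter>a. - {F :: nat \<Rightarrow> 'h. good a (F ` {..<Suc m}) \<and> f a (F 0) \<noteq> g a (F 0)})"
    by (intro closed_INT ballI closed_Compl)
  moreover have "(\<Inter>a. - {F :: nat \<Rightarrow> 'h. good a (F ` {..<Suc m}) \<and> f a (F 0) \<noteq> g a (F 0)}) =
      {F. \<forall>a. good a (F ` {..<Suc m}) \<longrightarrow> f a (F 0) = g a (F 0)}" by blast
  ultimately show ?thesis by simp
qed

section \<open>Descriptive complexity of the ideal\<close>

text \<open>A code of a member \<open>A\<close> of the ideal consists of the characteristic function
  of \<open>A\<close> and a sequence whose first \<open>m\<close> terms list a witnessing finite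
  set.\<close>

definition codes :: "nat \<Rightarrow> ((nat \<Rightarrow> real) \<times> (nat \<Rightarrow> 'h)) set" where
  "codes m = {(b, F). (\<forall>a. b a \<in> {0, 1}) \<and> (\<forall>a. b a = 1 \<longrightarrow> \<not> good a (F ` {..<m}))}"

lemma closed_codes: "closed (codes m)"
proof -
  have coord: "continuous_on UNIV (\<lambda>p :: (nat \<Rightarrow> real) \<times> (nat \<Rightarrow> 'h). fst p a)" for a
    by (rule continuous_on_product_then_coordinatewise[OF continuous_on_fst[OF continuous_on_id]])
  have "codes m = (\<Inter>a. (\<lambda>p. fst p a) -` {0, 1} \<inter> ((\<lambda>p. fst p a) -` {0} \<union> snd -` (- {F. good a (F ` {..<m})})))"
  proof (rule set_eqI)
    fix p
    have "p \<in> codes m \<longleftrightarrow>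
        (\<forall>a. fst p a \<in> {0, 1} \<and> (fst p a = 0 \<or> \<not> good a (snd p ` {..<m})))"
      unfolding codes_def case_prod_beta mem_Collect_eq by (metis insert_iff singletonD zero_neq_one)
    then show "p \<in> codes m \<longleftrightarrow> p \<in> (\<Inter>a. (\<lambda>p. fst p a) -` {0, 1} \<inter>
        ((\<lambda>p. fst p a) -` {0} \<union> snd -` (- {F. good a (F ` {..<m})})))"
      by simp
  qed
  also have "closed \<dots>"
    by (intro closed_INT ballI closed_Int closed_Un closed_vimage coord closed_Compl open_good
        continuous_on_snd continuous_on_id) auto
  finally show ?thesis .
qed

lemma char_funs_non_additivity:
  "char_funs non_additivity_ideal = (\<Union>m. (\<lambda>p a. fst p a = 1) ` codes m)"
proof (intro set_eqI iffI)
  fix c assume "c \<in> char_funs non_additivity_ideal"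
  then obtain A S where A: "c = (\<lambda>a. a \<in> A)" "finite S" "\<forall>a\<in>A. \<not> good a S"
    unfolding char_funs_def non_additivity_ideal_def by auto
  obtain e m where "S = e ` {i::nat. i < m}" using A(2) finite_imp_nat_seg_image_inj_on by metis
  then have S: "S = e ` {..<m}" by (simp add: lessThan_def)
  have "(\<lambda>a. of_bool (a \<in> A), e) \<in> codes m"
    using A(3) S unfolding codes_def by auto
  moreover have "c = (\<lambda>p a. fst p a = 1) (\<lambda>a. of_bool (a \<in> A) :: real, e)"
    using A(1) by auto
  ultimately show "c \<in> (\<Union>m. (\<lambda>p a. fst p a = 1) ` codes m)" by blast
next
  fix c assume "c \<in> (\<Union>m. (\<lambda>p a. fst p a = 1) ` codes m)"
  then obtain m b F where b: "(b, F) \<in> codes m" "c = (\<lambda>a. b a = 1)" by auto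
  then have "{a. b a = 1} \<in> non_additivity_ideal"
    unfolding non_additivity_ideal_def codes_def by (intro CollectI exI[of _ "F ` {..<m}"]) auto
  then show "c \<in> char_funs non_additivity_ideal"
    unfolding char_funs_def b(2) by (intro image_eqI[of _ _ "{a. b a = 1}"]) auto
qed

lemma codes_subset: "codes m \<subseteq> {b. \<forall>a. b a \<in> {0, 1}} \<times> UNIV"
  unfolding codes_def by auto

lemma analytic_ideal_non_additivity: "analytic_ideal non_additivity_ideal"
proof -
  have "analytic_set (\<Union>m. (\<lambda>p a. fst p a = 1) ` codes m)"
    using codes_subset
    by (intro analytic_set_UN_continuous_images closed_codes
        continuous_on_subset[OF continuous_on_code_char_fun]) blast
  then show ?thesis
    using set_ideal_non_additivity char_funs_non_additivity unfolding analytic_ideal_def by simp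
qed

text \<open>Witnesses confined to a fixed compact set form, by Tychonoff, a compact set of codes,
  whose image is compact and hence closed. Countably many such images exhaust the ideal.\<close>

lemma Fsigma_ideal_non_additivity:
  assumes "sigma_compact (UNIV :: 'h set)"
  shows "Fsigma_ideal non_additivity_ideal"
proof -
  obtain K :: "nat \<Rightarrow> 'h set" where K: "\<And>n. compact (K n)" "(\<Union>n. K n) = UNIV"
    using assms unfolding sigma_compact_def by metis
  \<comment> \<open>The sets increase, so that finitely many points fit into one of them. They
    contain 0, to which all coordinates from \<open>m\<close> on can be reset.\<close>
  define K' where "K' n = insert 0 (\<Union>i\<le>n. K i)" for n
  have K'_compact: "compact (K' n)" for n
    unfolding K'_def using K(1) by (intro compact_insert compact_UN) auto
  have K'_mono: "K' n \<subseteq> K' n'" if "n \<le> n'" for n n'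
    unfolding K'_def using that by (intro insert_mono UN_mono) auto
  have K'_cover: "\<exists>n. \<forall>i<m. F i \<in> K' n" for m :: nat and F
  proof (induction m)
    case (Suc m)
    then obtain n where n: "\<forall>i<m. F i \<in> K' n" by blast
    obtain n' where "F m \<in> K n'" using K(2) by blast
    then have "F m \<in> K' (max n n')" unfolding K'_def by auto
    then show ?case
      using n K'_mono[of n "max n n'"] by (intro exI[of _ "max n n'"]) (auto simp: less_Suc_eq)
  qed simp
  define h :: "(nat \<Rightarrow> real) \<times> (nat \<Rightarrow> 'h) \<Rightarrow> nat \<Rightarrow> bool" where "h p a \<longleftrightarrow> fst p a = 1" for p a
  define E where "E m n = codes m \<inter> {b. \<forall>a. b a \<in> {0, 1}} \<times> {F. \<forall>i. F i \<in> K' n}" for m n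
  have "compact (E m n)" for m n
    unfolding E_def
    using compact_Pi_UNIV[of "\<lambda>_. {0, 1 :: real}"] compact_Pi_UNIV[of "\<lambda>_. K' n"] K'_compact
    by (intro closed_Int_compact closed_codes compact_Times) auto
  moreover have "continuous_on (E m n) h" for m n
    unfolding h_def E_def by (rule continuous_on_subset[OF continuous_on_code_char_fun]) auto
  ultimately have closed: "closed (h ` E m n)" for m n
    by (intro compact_imp_closed_char_funs compact_continuous_image)
  have "(\<Union>m. h ` codes m) = (\<Union>m. \<Union>n. h ` E m n)"
  proof (intro equalityI subsetI)
    fix c assume "c \<in> (\<Union>m. h ` codes m)"
    then obtain m b F where b: "(b, F) \<in> codes m" "c = h (b, F)" by auto
    obtain n where n: "\<forall>i<m. F i \<in> K' n" using K'_cover by blast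
    define G where "G i = (if i < m then F i else 0)" for i
    have "G ` {..<m} = F ` {..<m}" unfolding G_def by simp
    then have "(b, G) \<in> codes m" using b(1) unfolding codes_def by simp
    moreover have "\<forall>i. G i \<in> K' n" using n unfolding G_def K'_def by auto
    ultimately have "(b, G) \<in> E m n" unfolding E_def using codes_subset by blast
    moreover have "c = h (b, G)" using b(2) unfolding h_def by simp
    ultimately show "c \<in> (\<Union>m. \<Union>n. h ` E m n)" by blast
  qed (auto simp: E_def)
  moreover have "fsigma_in euclidean (\<Union>n. h ` E m n)" for m
    by (rule fsigma_in_Union) (auto intro: closed_imp_fsigma_in simp: closed)
  then have "fsigma_in euclidean (\<Union>m. \<Union>n. h ` E m n)"
    by (intro fsigma_in_Union) auto
  ultimately have "fsigma_in euclidean (char_funs non_additivity_ideal)"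
    unfolding char_funs_non_additivity h_def[abs_def] by simp
  then show ?thesis using set_ideal_non_additivity unfolding Fsigma_ideal_def by simp
qed

section \<open>Failure of approximation by continuous homomorphisms\<close>

lemma not_approximable:
  assumes nondiscrete: "\<not> open {0 :: 'h}"
    and D: "separating_range D"
    and interpolates: "\<And>S \<phi>. finite S \<Longrightarrow> \<phi> ` S \<subseteq> D \<Longrightarrow> \<exists>a. S \<subseteq> R a \<and> (\<forall>u\<in>S. f a u = \<phi> u)"
  shows "\<not> approximable_by_continuous_hom non_additivity_ideal (\<lambda>x a. f a x)"
proof
  assume "approximable_by_continuous_hom non_additivity_ideal (\<lambda>x a. f a x)"
  then obtain g where g: "continuous_hom g" "\<And>x. {a. f a x \<noteq> g x a} \<in> non_additivity_ideal"
    unfolding approximable_by_continuous_hom_def by auto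
  have g_cont: "continuous_on UNIV (\<lambda>x. g x a)" for a
    using g(1) unfolding continuous_hom_def
    by (blast intro: continuous_on_product_then_coordinatewise)
  have "g (x + y) = g x + g y" for x y
    using g(1) unfolding continuous_hom_def by blast
  then have g_add: "g (x + y) a = g x a + g y a" for x y a
    by simp
  \<comment> \<open>A tuple in \<open>H m\<close> plays the role of S_x for \<open>x = F 0\<close>,
    with at most \<open>m + 1\<close> points. Pairing it with \<open>x\<close> presents the set of
    such \<open>x\<close> as a projection of the closed set \<open>C m\<close>.\<close>
  define H where "H m = {F :: nat \<Rightarrow> 'h. \<forall>a. good a (F ` {..<Suc m}) \<longrightarrow> f a (F 0) = g (F 0) a}" for m
  define C where "C m = {p :: 'h \<times> (nat \<Rightarrow> 'h). fst p = snd p 0} \<inter> snd -` H m" for m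
  have C_closed: "closed (C m)" for m
    unfolding C_def
  proof (intro closed_Int closed_vimage closed_Collect_eq continuous_on_fst continuous_on_snd
        continuous_on_id)
    show "closed (H m)" unfolding H_def using closed_agreement[of "\<lambda>a x. g x a"] g_cont by simp
    show "continuous_on UNIV (\<lambda>p :: 'h \<times> (nat \<Rightarrow> 'h). snd p 0)"
      by (rule continuous_on_product_then_coordinatewise[OF continuous_on_snd[OF continuous_on_id]])
  qed
  have in_A: "x \<in> fst ` C m \<longleftrightarrow> (\<exists>F\<in>H m. F 0 = x)" for x m
    unfolding C_def image_iff Bex_def by auto
  have "x \<in> (\<Union>m. fst ` C m)" for x
  proof -
    obtain S where S: "finite S" "\<And>a. f a x \<noteq> g x a \<Longrightarrow> \<not> good a S"
      using g(2)[of x] unfolding non_additivity_ideal_def by auto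
    obtain xs where xs: "set xs = S" using finite_list[OF S(1)] by blast
    \<comment> \<open>Only the first \<open>Suc (length xs)\<close> coordinates are read, so the
      values past the end of the list are irrelevant.\<close>
    define F where "F i = (x # xs) ! i" for i
    have "F ` {..<Suc (length xs)} = insert x S"
      unfolding F_def using xs nth_image[of "Suc (length xs)" "x # xs"] by (simp add: lessThan_atLeast0)
    then have "F \<in> H (length xs)"
      unfolding H_def using S(2) good_subset[of _ "insert x S" S] by (auto simp: F_def)
    moreover have "F 0 = x" unfolding F_def by simp
    ultimately show ?thesis using in_A by blast
  qed
  then have cover: "(\<Union>m. fst ` C m) = UNIV" by blast
  have "\<not> meager (UNIV :: 'h set)" by (rule open_not_meager) auto
  then obtain m where "\<not> meager (fst ` C m)"
    using meager_UN[of "UNIV :: nat set" "\<lambda>m. fst ` C m"] cover by auto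
  then obtain U where U: "open U" "U \<noteq> {}" "meager (U - fst ` C m)"
    using closed_projection_comeager_in_open[OF C_closed] by blast
  obtain x1 where x1: "x1 \<in> U" using U(2) by blast
  have "open ((+) x1 -` U)" using U(1) by (intro open_vimage continuous_intros)
  moreover have "0 \<in> (+) x1 -` U" using x1 by simp
  \<comment> \<open>One summand from \<open>V\<close> will lead from \<open>x1\<close> to
    \<open>x0\<close>, the other will be an element of \<open>sumset3 L\<close>.\<close>
  ultimately obtain V where V: "open V" "0 \<in> V" "\<And>v w. v \<in> V \<Longrightarrow> w \<in> V \<Longrightarrow> v + w \<in> (+) x1 -` U"
    using add_neighbourhood by blast
  obtain L where L: "finite L" "0 \<in> L" "tripling_bound (Suc m) \<le> card L" "sumset3 L \<subseteq> V"
      "card (sumset3 L) \<le> 3 * card L"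
    using small_tripling_in_neighbourhood[OF nondiscrete V(1,2)] by blast
  have "meager (\<Union>l\<in>sumset3 L. (\<lambda>x. x + l) -` (U - fst ` C m))"
    using L(1) U(3) by (intro meager_UN meager_translate) (auto intro: countable_finite)
  moreover have "\<not> meager ((\<lambda>x. x - x1) -` V)"
  proof (rule open_not_meager)
    show "open ((\<lambda>x. x - x1) -` V)" using V(1) by (intro open_vimage continuous_intros)
    have "x1 \<in> (\<lambda>x. x - x1) -` V" using V(2) by simp
    then show "(\<lambda>x. x - x1) -` V \<noteq> {}" by blast
  qed
  ultimately have "\<not> (\<lambda>x. x - x1) -` V \<subseteq> (\<Union>l\<in>sumset3 L. (\<lambda>x. x + l) -` (U - fst ` C m))"
    using meager_subset by metis
  then obtain x0 where x0: "x0 - x1 \<in> V" "\<And>l. l \<in> sumset3 L \<Longrightarrow> x0 + l \<notin> U - fst ` C m"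
    by blast
  define Y where "Y = (+) x0 ` sumset3 L"
  have Y: "\<exists>F. y \<in> Y \<longrightarrow> F \<in> H m \<and> F 0 = y" for y
  proof (cases "y \<in> Y")
    case True
    then obtain l where l: "l \<in> sumset3 L" "y = x0 + l" unfolding Y_def by blast
    then have "(x0 - x1) + l \<in> (+) x1 -` U" using V(3) x0(1) L(4) by blast
    then have "y \<in> fst ` C m" using x0(2)[OF l(1)] l(2) by simp
    then show ?thesis using in_A by blast
  qed simp
  then obtain F where F: "\<And>y. y \<in> Y \<Longrightarrow> F y \<in> H m \<and> F y 0 = y" by metis
  define S where "S y = F y ` {..<Suc m}" for y
  have S: "finite (S y) \<and> card (S y) \<le> Suc m \<and> y \<in> S y" if "y \<in> Y" for y
    using card_image_le[of "{..<Suc m}" "F y"] F[OF that] unfolding S_def by force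
  have agree: "f a y = g y a" if "y \<in> Y" "good a (S y)" for a y
    using F[OF that(1)] that(2) unfolding H_def S_def by force
  have "\<exists>x s t. \<exists>\<phi> :: 'h \<Rightarrow> 'h. {x, x + s, x + t, x + s + t} \<subseteq> Y \<and> partial_hom_on (S x) \<phi> \<and>
      \<phi> x \<noteq> 0 \<and> (\<forall>u \<in> S x \<inter> (S (x + s) \<union> S (x + t) \<union> S (x + s + t)). \<phi> u = 0)"
    by (rule partial_hom_vanishing_on_parallelogram[OF L(1,2,3,5) Y_def S])
  then obtain x s t and \<phi> :: "'h \<Rightarrow> 'h" where xst: "{x, x + s, x + t, x + s + t} \<subseteq> Y"
    and \<phi>: "partial_hom_on (S x) \<phi>" "\<phi> x \<noteq> 0"
      "\<forall>u \<in> S x \<inter> (S (x + s) \<union> S (x + t) \<union> S (x + s + t)). \<phi> u = 0"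
    by blast
  define Q where "Q = S (x + s) \<union> S (x + t) \<union> S (x + s + t)"
  have Sx: "finite (S x)" "x \<in> S x" using S xst by auto
  have "\<exists>\<psi> :: 'h \<Rightarrow> 'h. partial_hom_on (S x) \<psi> \<and> \<psi> x \<noteq> 0 \<and> (\<forall>u\<in>S x \<inter> Q. \<psi> u = 0) \<and> \<psi> ` S x \<subseteq> D"
    using D Sx \<phi> unfolding separating_range_def Q_def by blast
  then obtain \<psi> :: "'h \<Rightarrow> 'h" where \<psi>: "partial_hom_on (S x) \<psi>" "\<psi> x \<noteq> 0"
      "\<forall>u\<in>S x \<inter> Q. \<psi> u = 0" "\<psi> ` S x \<subseteq> D"
    by blast
  have "finite Q" unfolding Q_def using S xst by simp
  then have "finite (S x \<union> Q)" using Sx(1) by simp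
  moreover have "(\<lambda>u. if u \<in> S x then \<psi> u else 0) ` (S x \<union> Q) \<subseteq> D"
    using \<psi>(4) D unfolding separating_range_def by auto
  \<comment> \<open>Extending \<open>\<psi>\<close> by 0 to \<open>Q\<close> is consistent because
    \<open>\<psi>\<close> vanishes on the overlap. Some \<open>f a\<close> realizes this extension
    and has no jump at any of the points.\<close>
  ultimately obtain a where a: "S x \<union> Q \<subseteq> R a"
      "\<forall>u\<in>S x \<union> Q. f a u = (if u \<in> S x then \<psi> u else 0)"
    using interpolates by blast
  have "good a (S x)" using a \<psi>(1) unfolding good_def partial_hom_on_def by simp
  then have "g x a \<noteq> 0" using agree[of x a] xst a(2) Sx(2) \<psi>(2) by simp
  \<comment> \<open>On the set of a corner other than \<open>x\<close> the function
    \<open>f a\<close> is identically 0, hence additive, which forces \<open>g\<close> to agree with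
    it at that corner.\<close>
  moreover have zero: "g y a = 0" if y: "S y \<subseteq> Q" "y \<in> Y" for y
  proof -
    have f0: "f a u = 0" if "u \<in> S y" for u using a(2) \<psi>(3) y(1) that by auto
    then have "good a (S y)" using a(1) y(1) unfolding good_def partial_hom_on_def by auto
    then show ?thesis using agree[OF y(2), of a] f0[of y] S[OF y(2)] by simp
  qed
  have "g (x + s) a = 0" "g (x + t) a = 0" "g (x + s + t) a = 0"
    using xst by (intro zero; auto simp: Q_def)+
  \<comment> \<open>Comparing the corners \<open>x + s\<close> and \<open>x + s + t\<close> gives
    \<open>g t a = 0\<close>, and then the corner \<open>x + t\<close> gives the claim.\<close>
  then have "g x a = 0" unfolding g_add by (metis add.right_neutral add_0)
  ultimately show False by blast
qed

end

section \<open>Nondiscreteness and conclusion\<close>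

text \<open>If 0 were isolated, translations would make every singleton open, and a countable basis
  would have to contain all of them.\<close>

lemma uncountable_imp_not_open_zero:
  assumes "uncountable (UNIV :: 'h::{second_countable_topology, topological_ab_group_add} set)"
  shows "\<not> open {0 :: 'h}"
proof
  assume zero: "open {0 :: 'h}"
  have sing: "open {x}" for x :: 'h
  proof -
    have "open ((\<lambda>y. y - x) -` {0})" using zero by (intro open_vimage continuous_intros)
    moreover have "(\<lambda>y. y - x) -` {0} = {x}" by auto
    ultimately show ?thesis by simp
  qed
  obtain B :: "'h set set" where B: "countable B" "topological_basis B"
    using ex_countable_basis by blast
  have "{x} \<in> B" for x
  proof -
    obtain W where "W \<in> B" "x \<in> W" "W \<subseteq> {x}"
      using topological_basisE[OF B(2) sing[of x]] by blast
    then show ?thesis by (metis singletonD subset_singletonD empty_iff)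
  qed
  then have "range (\<lambda>x :: 'h. {x}) \<subseteq> B" by blast
  then have "countable (range (\<lambda>x :: 'h. {x}))" using B(1) countable_subset by blast
  then have "countable (UNIV :: 'h set)" by (rule countable_image_inj_on) (simp add: inj_on_def)
  then show False using assms by blast
qed

theorem theorem1:
  assumes "uncountable (UNIV :: 'h::{polish_space, topological_ab_group_add} set)"
  shows "(\<exists>Z :: nat set set. analytic_ideal Z \<and>
            (\<exists>f :: 'h \<Rightarrow> nat \<Rightarrow> 'h. f \<in> borel_measurable borel \<and> approximate_hom Z f \<and>
               \<not> approximable_by_continuous_hom Z f)) \<and>
         (sigma_compact (UNIV :: 'h set) \<longrightarrow>
          (\<exists>Z :: nat set set. analytic_ideal Z \<and> Fsigma_ideal Z \<and>
            (\<exists>f :: 'h \<Rightarrow> nat \<Rightarrow> 'h. f \<in> borel_measurable borel \<and> approximate_hom Z f \<and>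
               \<not> approximable_by_continuous_hom Z f)))"
proof -
  obtain D :: "'h set" where D: "countable D" "separating_range D"
    using countable_separating_range by blast
  have "0 \<in> D" using D(2) unfolding separating_range_def by blast
  with D(1) show ?thesis
  proof (rule locally_constant_interpolating_family)
    fix f :: "nat \<Rightarrow> 'h \<Rightarrow> 'h" and R
    assume open_R: "\<And>a. open (R a)" and f: "\<And>a. f a \<in> borel_measurable borel"
      and loc: "\<And>a x. x \<in> R a \<Longrightarrow> \<exists>U. open U \<and> x \<in> U \<and> (\<forall>y\<in>U. f a y = f a x)"
      and interpolates: "\<And>S \<phi>. finite S \<Longrightarrow> \<phi> ` S \<subseteq> D \<Longrightarrow> \<exists>a. S \<subseteq> R a \<and> (\<forall>u\<in>S. f a u = \<phi> u)"
    interpret locally_constant_family f R by unfold_locales (rule open_R, rule loc)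
    have "(\<lambda>x a. f a x) \<in> borel_measurable borel"
      by (rule measurable_coordinatewise_then_product) (rule f)
    moreover have "\<not> approximable_by_continuous_hom non_additivity_ideal (\<lambda>x a. f a x)"
      by (rule not_approximable[OF uncountable_imp_not_open_zero[OF assms] D(2) interpolates])
    \<comment> \<open>The same ideal and the same map serve both claims, since the family is built
      without reference to sigma-compactness.\<close>
    ultimately show ?thesis
      using analytic_ideal_non_additivity Fsigma_ideal_non_additivity approximate_hom_family by blast
  qed
qed

end
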